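(* Let $f:S^n\to S^m$ be an LOMSE of Type (I), with associated angle $\theta$. Then its LOC segment $\{(r,\tan\theta\cdot r): r\in(0,1]\}$ is a stable geodesic in the quotient space $\{(r,\rho): r>0,\ \rho\in\mathbb R\}$ endowed with the canonical metric $$g_0=\sigma_0^2\,(r^2+\lambda^2\rho^2)^p\, r^{2(n-p)}\,(dr^2+d\rho^2).$$
   Context: **Lawson–Osserman maps.** A smooth map $f:S^n\to S^m$ between unit spheres is a Lawson–Osserman map (LOM) if there is an acute angle $\theta\in(0,\pi/2)$ such that $M_{f,\theta}=\{(\cos\theta\, x,\ \sin\theta\, f(x)): x\in S^n\}$ is a minimal submanifold of the unit sphere $S^{m+n+1}\subset\mathbb R^{m+n+2}$. The cone over $M_{f,\theta}$ is the associated Lawson–Osserman cone (LOC). **LOMSE.** An LOM $f$ is an LOMSE if at each $x\in S^n$ all nonzero singular values of the differential $(f_* )_x:T_xS^n\to T_{f(x)}S^m$ (with respect to the standard round metrics) are equal, i.e. the set of singular values is $\{0,\lambda\}$ with $\lambda>0$. For an LOMSE it is known that $\lambda$ and the multiplicity $p$ of $\lambda$ (so $0$ has multiplicity $n-p>0$) do not depend on $x$; that $f=i\circ\pi$ where $\pi$ is a Hopf fibration from $S^n$ onto a complex, quaternionic or octonionic projective space $(\mathbb P^p,h)$ of real dimension $p$ and $i:(\mathbb P^p,\lambda^2h)\to S^m$ is a minimal isometric immersion; and that the $m+1$ components of $f$ are spherical harmonics of a common even degree $k$, with $\lambda=\sqrt{k(k+n-1)/p}$. One says $f$ is of $(n,p,k)$-type.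 The angle is then determined by $\tan^2\theta=\dfrac{p-n\lambda^{-2}}{n-p}$. **Type (I).** $f$ is of Type (I) if $(n,p,k)\in\{(3,2,2),(5,4,2),(5,4,4)\}$ or $n\ge 7$. **Quotient space.** $\sigma_0$ denotes the volume of the unit sphere $S^n$. The point $(r,\rho)$ represents the $n$-dimensional submanifold $\{(rx,\rho f(x)): x\in S^n\}$ of $\mathbb R^{m+n+2}$. The LOC curve $\{\rho=\tan\theta\cdot r,\ r>0\}$ represents the LOC and is a geodesic of $g_0$; the LOC segment is its part with $r\in(0,1]$ (open at the origin). **Stability.** The LOC segment is stable if the second variation of $g_0$-length is nonnegative for every variation compactly supported in the interior $\{0<r<1\}$ of the segment, and unstable if it is negative for some such variation. *)

theory Defs
  imports "HOL-Analysis.Analysis"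
begin

section \<open>Smooth maps\<close>

text \<open>Both notions below are meant for open \<open>U\<close>. In finite dimension, being \<open>C\<^sup>k\<^sup>+\<^sup>1\<close> amounts to
  being differentiable with all directional derivatives \<open>C\<^sup>k\<close>.\<close>

primrec Ck_on ::
  "nat \<Rightarrow> 'a::real_normed_vector set \<Rightarrow> ('a \<Rightarrow> 'b::real_normed_vector) \<Rightarrow> bool" where
  "Ck_on 0 U f \<longleftrightarrow> continuous_on U f"
| "Ck_on (Suc k) U f \<longleftrightarrow>
     (\<exists>f'. (\<forall>x\<in>U. (f has_derivative f' x) (at x)) \<and> (\<forall>v. Ck_on k U (\<lambda>x. f' x v)))"

definition smooth_on ::
  "'a::real_normed_vector set \<Rightarrow> ('a \<Rightarrow> 'b::real_normed_vector) \<Rightarrow> bool" where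
  "smooth_on U f \<longleftrightarrow> (\<forall>k. Ck_on k U f)"

text \<open>Smoothness on an arbitrary subset (in use: a submanifold): \<open>f\<close> is locally the restriction of
  a smooth map defined on an open set of the ambient space.\<close>

definition smooth_map_on ::
  "'a::real_normed_vector set \<Rightarrow> ('a \<Rightarrow> 'b::real_normed_vector) \<Rightarrow> bool" where
  "smooth_map_on S f \<longleftrightarrow>
     (\<forall>x\<in>S. \<exists>U F. open U \<and> x \<in> U \<and> smooth_on U F \<and> (\<forall>y\<in>U \<inter> S. F y = f y))"

section \<open>Submanifolds of Euclidean space and minimality in the unit sphere\<close>

definition smooth_submanifold :: "nat \<Rightarrow> 'a::euclidean_space set \<Rightarrow> bool" where
  "smooth_submanifold d M \<longleftrightarrow>
     (\<forall>y\<in>M. \<exists>U V (\<phi> :: 'a \<Rightarrow> 'a) \<psi> L.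
        open U \<and> y \<in> U \<and> open V \<and> homeomorphism U V \<phi> \<psi> \<and> smooth_on U \<phi> \<and> smooth_on V \<psi> \<and>
        subspace L \<and> dim L = d \<and> \<phi> ` (U \<inter> M) = V \<inter> L)"

definition tangent_space :: "'a::euclidean_space set \<Rightarrow> 'a \<Rightarrow> 'a set" where
  "tangent_space M y =
     {v. \<exists>c (\<epsilon>::real). \<epsilon> > 0 \<and> smooth_on {-\<epsilon><..<\<epsilon>} c \<and> c ` {-\<epsilon><..<\<epsilon>} \<subseteq> M \<and> c 0 = y \<and>
            (c has_vector_derivative v) (at 0)}"

text \<open>\<open>b\<close> is the value \<open>II\<^sub>y(v,w)\<close> of the second fundamental form of \<open>M\<close> as a submanifold of the unit
  sphere: extend \<open>w\<close> to a smooth tangent vector field \<open>W\<close> of \<open>M\<close> and take the component of the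
  directional derivative \<open>D\<^sub>v W\<close> that is tangent to the sphere (orthogonal to \<open>y\<close>) and normal to \<open>M\<close>.
  The derivative \<open>D\<close> is taken within \<open>M\<close>, so only its values on tangent vectors of \<open>M\<close> matter.\<close>

definition sphere_second_fundamental_form ::
  "'a::euclidean_space set \<Rightarrow> 'a \<Rightarrow> 'a \<Rightarrow> 'a \<Rightarrow> 'a \<Rightarrow> bool" where
  "sphere_second_fundamental_form M y v w b \<longleftrightarrow>
     b \<bullet> y = 0 \<and> (\<forall>u\<in>tangent_space M y. b \<bullet> u = 0) \<and>
     (\<exists>W D. smooth_map_on M W \<and> (\<forall>z\<in>M. W z \<in> tangent_space M z) \<and> W y = w \<and>
            (W has_derivative D) (at y within M) \<and>
            D v - b \<in> span (insert y (tangent_space M y)))"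

text \<open>A \<open>d\<close>-dimensional submanifold of the unit sphere is minimal if its mean curvature vector, the
  trace of the second fundamental form over an orthonormal basis of the tangent space, vanishes
  everywhere. The trace does not depend on the basis.\<close>

definition minimal_submanifold_of_sphere :: "nat \<Rightarrow> 'a::euclidean_space set \<Rightarrow> bool" where
  "minimal_submanifold_of_sphere d M \<longleftrightarrow>
     M \<subseteq> sphere 0 1 \<and> smooth_submanifold d M \<and>
     (\<forall>y\<in>M. \<exists>B II. pairwise orthogonal B \<and> (\<forall>e\<in>B. norm e = 1) \<and> span B = tangent_space M y \<and>
        (\<forall>e\<in>B. sphere_second_fundamental_form M y e e (II e)) \<and> (\<Sum>e\<in>B. II e) = 0)"

section \<open>Lawson--Osserman maps\<close>

text \<open>A map \<open>S\<^sup>n \<rightarrow> S\<^sup>m\<close> is a function \<open>'a \<Rightarrow> 'b\<close> with \<open>DIM('a) = n + 1\<close> and \<open>DIM('b) = m + 1\<close>; only its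
  values on \<open>sphere 0 1\<close> are relevant. The space \<open>'a \<times> 'b\<close> carries the Euclidean inner product.\<close>

definition LOM_submanifold ::
  "('a::euclidean_space \<Rightarrow> 'b::euclidean_space) \<Rightarrow> real \<Rightarrow> ('a \<times> 'b) set" where
  "LOM_submanifold f \<theta> = (\<lambda>x. (cos \<theta> *\<^sub>R x, sin \<theta> *\<^sub>R f x)) ` sphere 0 1"

definition LOM_angle :: "('a::euclidean_space \<Rightarrow> 'b::euclidean_space) \<Rightarrow> real \<Rightarrow> bool" where
  "LOM_angle f \<theta> \<longleftrightarrow> 0 < \<theta> \<and> \<theta> < pi / 2 \<and>
     minimal_submanifold_of_sphere (DIM('a) - 1) (LOM_submanifold f \<theta>)"

definition LOM :: "('a::euclidean_space \<Rightarrow> 'b::euclidean_space) \<Rightarrow> bool" where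
  "LOM f \<longleftrightarrow> smooth_map_on (sphere 0 1) f \<and> f ` sphere 0 1 \<subseteq> sphere 0 1 \<and> (\<exists>\<theta>. LOM_angle f \<theta>)"

text \<open>The differential of \<open>f\<close> at \<open>x\<close> is the Frechet derivative within the sphere. It is determined on
  tangent vectors only, and is only applied to these.\<close>

abbreviation sphere_differential ::
  "('a::euclidean_space \<Rightarrow> 'b::euclidean_space) \<Rightarrow> 'a \<Rightarrow> 'a \<Rightarrow> 'b" where
  "sphere_differential f x \<equiv> frechet_derivative f (at x within sphere 0 1)"

text \<open>The eigenspace of \<open>A\<^sup>*A\<close> for the eigenvalue \<open>\<sigma>\<^sup>2\<close>, where \<open>A\<close> is the differential of \<open>f\<close> at \<open>x\<close> on the
  tangent space: \<open>A\<^sup>*A v = \<sigma>\<^sup>2 v\<close> is tested against all tangent vectors \<open>w\<close>.\<close>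

definition singular_space ::
  "('a::euclidean_space \<Rightarrow> 'b::euclidean_space) \<Rightarrow> 'a \<Rightarrow> real \<Rightarrow> 'a set" where
  "singular_space f x \<sigma> =
     {v \<in> tangent_space (sphere 0 1) x. \<forall>w \<in> tangent_space (sphere 0 1) x.
        sphere_differential f x v \<bullet> sphere_differential f x w = \<sigma>\<^sup>2 * (v \<bullet> w)}"

definition singular_values ::
  "('a::euclidean_space \<Rightarrow> 'b::euclidean_space) \<Rightarrow> 'a \<Rightarrow> real set" where
  "singular_values f x = {\<sigma>. 0 \<le> \<sigma> \<and> (\<exists>v\<in>singular_space f x \<sigma>. v \<noteq> 0)}"

definition singular_multiplicity ::
  "('a::euclidean_space \<Rightarrow> 'b::euclidean_space) \<Rightarrow> 'a \<Rightarrow> real \<Rightarrow> nat" where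
  "singular_multiplicity f x \<sigma> = dim (singular_space f x \<sigma>)"

text \<open>The value \<open>lam\<close> is not required to be the same at all points; that it is constant is a consequence
  of minimality.\<close>

definition LOMSE :: "('a::euclidean_space \<Rightarrow> 'b::euclidean_space) \<Rightarrow> bool" where
  "LOMSE f \<longleftrightarrow> LOM f \<and> (\<forall>x\<in>sphere 0 1. \<exists>lam>0. singular_values f x = {0, lam})"

definition laplacian :: "('a::euclidean_space \<Rightarrow> real) \<Rightarrow> 'a \<Rightarrow> real" where
  "laplacian P x = (\<Sum>b\<in>Basis. (deriv ^^ 2) (\<lambda>t. P (x + t *\<^sub>R b)) 0)"

definition spherical_harmonic :: "nat \<Rightarrow> ('a::euclidean_space \<Rightarrow> real) \<Rightarrow> bool" where
  "spherical_harmonic k Y \<longleftrightarrow>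
     (\<exists>P. real_polynomial_function P \<and> (\<forall>c x. P (c *\<^sub>R x) = c ^ k * P x) \<and>
          (\<forall>x. laplacian P x = 0) \<and> (\<forall>x\<in>sphere 0 1. Y x = P x))"

definition LOMSE_type ::
  "('a::euclidean_space \<Rightarrow> 'b::euclidean_space) \<Rightarrow> nat \<Rightarrow> nat \<Rightarrow> nat \<Rightarrow> bool" where
  "LOMSE_type f n p k \<longleftrightarrow> LOMSE f \<and> DIM('a) = n + 1 \<and>
     (\<forall>x\<in>sphere 0 1. \<exists>lam>0. singular_values f x = {0, lam} \<and> singular_multiplicity f x lam = p) \<and>
     (\<forall>b\<in>Basis. spherical_harmonic k (\<lambda>x. f x \<bullet> b))"

text \<open>For \<open>n \<ge> 7\<close> the values of \<open>p\<close> and \<open>k\<close> play no role, so their existence is not demanded.\<close>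

definition LOMSE_type_I :: "('a::euclidean_space \<Rightarrow> 'b::euclidean_space) \<Rightarrow> bool" where
  "LOMSE_type_I f \<longleftrightarrow> LOMSE f \<and>
     ((\<exists>n p k. LOMSE_type f n p k \<and> (n, p, k) \<in> {(3, 2, 2), (5, 4, 2), (5, 4, 4)})
      \<or> DIM('a) - 1 \<ge> 7)"

section \<open>Stable geodesics\<close>

text \<open>A Riemannian metric on an open set \<open>N\<close> of a Euclidean space is given by its values \<open>g z u v\<close> at
  points \<open>z \<in> N\<close> on tangent vectors \<open>u\<close>, \<open>v\<close>.\<close>

definition curve_length ::
  "('a::euclidean_space \<Rightarrow> 'a \<Rightarrow> 'a \<Rightarrow> real) \<Rightarrow> real \<Rightarrow> real \<Rightarrow> (real \<Rightarrow> 'a) \<Rightarrow> real" where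
  "curve_length g a b c =
     integral {a..b} (\<lambda>t. sqrt (g (c t) (vector_derivative c (at t)) (vector_derivative c (at t))))"

text \<open>\<open>\<Gamma> s\<close> is a smooth variation of the curve \<open>c\<close> (parametrized over the interval \<open>I\<close>) that is constant
  outside the compact subinterval \<open>[a,b]\<close> of the interior of \<open>I\<close>. The change of length of the whole
  curve is then the change of length of its part over \<open>[a,b]\<close>.\<close>

definition compact_variation ::
  "'a::euclidean_space set \<Rightarrow> real set \<Rightarrow> (real \<Rightarrow> 'a) \<Rightarrow> real \<Rightarrow> real \<Rightarrow> (real \<Rightarrow> real \<Rightarrow> 'a) \<Rightarrow> bool"
  where
  "compact_variation N I c a b \<Gamma> \<longleftrightarrow>
     a < b \<and> {a..b} \<subseteq> interior I \<and> (\<forall>t\<in>interior I. \<Gamma> 0 t = c t) \<and>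
     (\<exists>\<epsilon>>0. smooth_on ({-\<epsilon><..<\<epsilon>} \<times> interior I) (\<lambda>(s, t). \<Gamma> s t) \<and>
        (\<forall>s\<in>{-\<epsilon><..<\<epsilon>}. \<forall>t\<in>interior I. \<Gamma> s t \<in> N \<and> (t \<notin> {a..b} \<longrightarrow> \<Gamma> s t = c t)))"

text \<open>Geodesics are understood up to reparametrization: regular curves that are critical for length
  under compactly supported variations.\<close>

definition geodesic_segment ::
  "'a::euclidean_space set \<Rightarrow> ('a \<Rightarrow> 'a \<Rightarrow> 'a \<Rightarrow> real) \<Rightarrow> real set \<Rightarrow> (real \<Rightarrow> 'a) \<Rightarrow> bool" where
  "geodesic_segment N g I c \<longleftrightarrow>
     c ` I \<subseteq> N \<and> smooth_map_on I c \<and> (\<forall>t\<in>I. vector_derivative c (at t within I) \<noteq> 0) \<and>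
     (\<forall>a b \<Gamma>. compact_variation N I c a b \<Gamma> \<longrightarrow>
        ((\<lambda>s. curve_length g a b (\<Gamma> s)) has_real_derivative 0) (at 0))"

definition stable_geodesic_segment ::
  "'a::euclidean_space set \<Rightarrow> ('a \<Rightarrow> 'a \<Rightarrow> 'a \<Rightarrow> real) \<Rightarrow> real set \<Rightarrow> (real \<Rightarrow> 'a) \<Rightarrow> bool" where
  "stable_geodesic_segment N g I c \<longleftrightarrow>
     geodesic_segment N g I c \<and>
     (\<forall>a b \<Gamma>. compact_variation N I c a b \<Gamma> \<longrightarrow>
        (deriv ^^ 2) (\<lambda>s. curve_length g a b (\<Gamma> s)) 0 \<ge> 0)"

section \<open>The quotient space\<close>

text \<open>The volume of \<open>S\<^sup>n\<close> is \<open>n + 1\<close> times the volume of the unit ball that it bounds.\<close>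

definition unit_sphere_vol :: "nat \<Rightarrow> real" where
  "unit_sphere_vol n = real (n + 1) * unit_ball_vol (real (n + 1))"

definition quotient_space :: "(real \<times> real) set" where
  "quotient_space = {(r, \<rho>). r > 0}"

text \<open>The inner product of \<open>real \<times> real\<close> is \<open>dr\<^sup>2 + d\<rho>\<^sup>2\<close>.\<close>

definition quotient_metric ::
  "nat \<Rightarrow> nat \<Rightarrow> real \<Rightarrow> real \<times> real \<Rightarrow> real \<times> real \<Rightarrow> real \<times> real \<Rightarrow> real" where
  "quotient_metric n p lam = (\<lambda>(r, \<rho>) u v.
     (unit_sphere_vol n)\<^sup>2 * (r\<^sup>2 + lam\<^sup>2 * \<rho>\<^sup>2) ^ p * r ^ (2 * (n - p)) * (u \<bullet> v))"

definition LOC_curve :: "real \<Rightarrow> real \<Rightarrow> real \<times> real" where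
  "LOC_curve \<theta> r = (r, tan \<theta> * r)"

end

theory Submission
  imports Defs
begin

text \<open>Write \<open>t = tan \<theta>\<close> and let \<open>X\<close>, \<open>Y\<close> be linear coordinates of the quotient space along and orthogonal
  to the LOC ray. With \<open>h = (n - 1)/2\<close>, the homogeneous function
  \<open>u = X\<^bsup>n+1\<^esup>/(n + 1) - (h/2) X\<^bsup>n-1\<^esup> Y\<^sup>2\<close> has, up to a constant factor, gradient of length at most the conformal
  factor near the ray, with equality on it: \<open>du\<close> calibrates the ray. So the segment has least length among
  nearby curves with the same end points, and the first and second variation follow from the
  differentiability of the length alone. The gradient estimate is a strict second derivative test for
  one-variable profiles, and amounts to \<open>2n (1 - n/(p\<lambda>\<^sup>2)) < (n + 1)\<^sup>2/4\<close>, the constant of Hardy's inequality.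

  Minimality enters by testing the mean curvature against the normal \<open>(- sin \<theta> x, cos \<theta> f x)\<close>, which gives
  \<open>p (\<lambda>\<^sup>2 - 1) = (n - p) (1 + \<lambda>\<^sup>2 t\<^sup>2)\<close>. For \<open>n \<ge> 7\<close> the inequality is then automatic; for the three
  remaining types the Laplacian of \<open>|f|\<^sup>2\<close>, for the harmonic extension of \<open>f\<close>, gives \<open>p \<lambda>\<^sup>2 = k (k + n - 1)\<close>.\<close>

section \<open>Calculus of smooth maps\<close>

text \<open>\<open>deriv ^^ 2\<close> carries information only where the length really is twice
  differentiable in s, and admissible variations are arbitrary: they may slide along the ray as well
  as leave it. A second variation formula would have to separate tangential from normal parts. The
  calibration treats all of them alike; the sign of the second derivative comes from a minimum and
  its existence from Leibniz' rule. Origin of h: with c in place of h, the potential X^(n+1)/(n+1) -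
  (c/2) X^(n-1) Y^2 has squared gradient X^(2n) (1 + (c^2 - (n-1) c) w^2 + O(w^4)), where w = Y/X.
  The best c minimises c^2 - (n-1) c, so c = (n-1)/2 and the minimum is -h^2. Gradient and conformal
  factor are both homogeneous of degree n. Hence their comparison depends on w alone, and a
  neighbourhood of w = 0 gives a whole cone around the ray, which contains every sufficiently small
  variation over a compact interval. In the final inequality f is present only through p lam^2; the
  angle equation and the energy identity are both evaluated at the single point x.\<close>

lemma Ck_on_Suc_imp: "Ck_on (Suc k) U f \<Longrightarrow> Ck_on k U f"
proof (induction k arbitrary: f)
  case 0
  then show ?case
    by (auto intro: continuous_at_imp_continuous_on has_derivative_continuous)
next
  case (Suc k)
  then obtain f' where "\<forall>x\<in>U. (f has_derivative f' x) (at x)" "\<forall>v. Ck_on (Suc k) U (\<lambda>x. f' x v)"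
    by auto
  with Suc.IH show ?case by (metis Ck_on.simps(2))
qed

lemma Ck_on_cong:
  assumes "open U" "Ck_on k U f" "\<And>x. x \<in> U \<Longrightarrow> f x = g x"
  shows "Ck_on k U g"
proof (cases k)
  case 0
  then show ?thesis using assms continuous_on_cong[of U U f g] by auto
next
  case (Suc j)
  then obtain f' where "\<forall>x\<in>U. (f has_derivative f' x) (at x)" "\<forall>v. Ck_on j U (\<lambda>x. f' x v)"
    using assms by auto
  moreover have "(g has_derivative f' x) (at x)" if "x \<in> U" for x
    using has_derivative_transform_within_open[of f "f' x" x UNIV U g] that calculation assms by auto
  ultimately show ?thesis using Suc by auto
qed

lemma Ck_on_subset: "Ck_on k U f \<Longrightarrow> V \<subseteq> U \<Longrightarrow> Ck_on k V f"
proof (induction k arbitrary: f)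
  case 0
  then show ?case using continuous_on_subset by auto
next
  case (Suc k)
  then obtain f' where f': "\<forall>x\<in>U. (f has_derivative f' x) (at x)" "\<forall>v. Ck_on k U (\<lambda>x. f' x v)"
    by auto
  then have "\<forall>v. Ck_on k V (\<lambda>x. f' x v)" using Suc by blast
  with f' Suc.prems show ?case by auto
qed

lemma Ck_on_const: "Ck_on k U (\<lambda>_. c)"
proof (induction k arbitrary: c)
  case (Suc k)
  then show ?case
    by (auto intro!: exI[of _ "\<lambda>_ _. 0"])
qed auto

lemma Ck_on_bounded_linear:
  assumes "bounded_linear h"
  shows "Ck_on k U h"
proof (cases k)
  case 0
  then show ?thesis using assms by (simp add: linear_continuous_on)
next
  case (Suc j)
  then show ?thesis using assms
    by (auto intro!: exI[of _ "\<lambda>_. h"] Ck_on_const bounded_linear_imp_has_derivative)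
qed

lemma Ck_on_compose_bounded_linear:
  assumes "bounded_linear h" "Ck_on k U f"
  shows "Ck_on k U (\<lambda>x. h (f x))"
  using assms(2)
proof (induction k arbitrary: f)
  case 0
  then show ?case using assms(1) by (auto intro: bounded_linear.continuous_on)
next
  case (Suc k)
  then obtain f' where "\<forall>x\<in>U. (f has_derivative f' x) (at x)" "\<forall>v. Ck_on k U (\<lambda>x. f' x v)"
    by auto
  then show ?case using Suc.IH
    by (auto intro!: exI[of _ "\<lambda>x v. h (f' x v)"] bounded_linear.has_derivative[OF assms(1)])
qed

lemma Ck_on_add:
  assumes "Ck_on k U f" "Ck_on k U g"
  shows "Ck_on k U (\<lambda>x. f x + g x)"
  using assms
proof (induction k arbitrary: f g)
  case 0
  then show ?case by (auto intro: continuous_on_add)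
next
  case (Suc k)
  then obtain f' g' where "\<forall>x\<in>U. (f has_derivative f' x) (at x)" "\<forall>v. Ck_on k U (\<lambda>x. f' x v)"
    "\<forall>x\<in>U. (g has_derivative g' x) (at x)" "\<forall>v. Ck_on k U (\<lambda>x. g' x v)"
    by auto
  then show ?case using Suc.IH
    by (auto intro!: exI[of _ "\<lambda>x v. f' x v + g' x v"] has_derivative_add)
qed

lemma Ck_on_sum:
  assumes "\<And>i. i \<in> I \<Longrightarrow> Ck_on k U (f i)"
  shows "Ck_on k U (\<lambda>x. \<Sum>i\<in>I. f i x)"
  using assms
  by (induction I rule: infinite_finite_induct) (auto intro: Ck_on_const Ck_on_add)

lemma Ck_on_bounded_bilinear:
  assumes "bounded_bilinear h" "Ck_on k U f" "Ck_on k U g"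
  shows "Ck_on k U (\<lambda>x. h (f x) (g x))"
  using assms(2,3)
proof (induction k arbitrary: f g)
  case 0
  then show ?case using bounded_bilinear.continuous_on[OF assms(1)] by auto
next
  case (Suc k)
  then obtain f' g' where "\<forall>x\<in>U. (f has_derivative f' x) (at x)" "\<forall>v. Ck_on k U (\<lambda>x. f' x v)"
    "\<forall>x\<in>U. (g has_derivative g' x) (at x)" "\<forall>v. Ck_on k U (\<lambda>x. g' x v)"
    by auto
  then show ?case using Suc.IH Ck_on_Suc_imp[OF Suc.prems(1)] Ck_on_Suc_imp[OF Suc.prems(2)]
    by (auto intro!: exI[of _ "\<lambda>x v. h (f x) (g' x v) + h (f' x v) (g x)"] Ck_on_add
        bounded_bilinear.FDERIV[OF assms(1)])
qed

text \<open>\<open>Ck_on\<close> controls derivatives in fixed directions, whereas the chain rule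
  evaluates \<open>F' (g x)\<close> in the direction \<open>g' x v\<close>, which moves with x.
  Expanding that direction in \<open>Basis\<close> leaves sums of products of C^k functions; here
  the finite dimension of the intermediate space enters.\<close>

lemma Ck_on_compose:
  fixes F :: "'a::euclidean_space \<Rightarrow> 'b::real_normed_vector"
    and g :: "'c::real_normed_vector \<Rightarrow> 'a"
  assumes "Ck_on k V F" "Ck_on k U g" "g ` U \<subseteq> V"
  shows "Ck_on k U (\<lambda>x. F (g x))"
  using assms(1,2)
proof (induction k arbitrary: F)
  case 0
  then show ?case using assms(3) continuous_on_compose2 by auto
next
  case (Suc k)
  then obtain F' g' where F': "\<forall>x\<in>V. (F has_derivative F' x) (at x)" "\<forall>v. Ck_on k V (\<lambda>x. F' x v)"
    and g': "\<forall>x\<in>U. (g has_derivative g' x) (at x)" "\<forall>v. Ck_on k U (\<lambda>x. g' x v)"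
    by auto
  have "((\<lambda>x. F (g x)) has_derivative (\<lambda>v. \<Sum>b\<in>Basis. (g' x v \<bullet> b) *\<^sub>R F' (g x) b)) (at x)"
    if "x \<in> U" for x
  proof -
    have "((\<lambda>x. F (g x)) has_derivative (\<lambda>v. F' (g x) (g' x v))) (at x)"
      using that F' g' assms(3) by (intro has_derivative_compose[of g "g' x" x UNIV F]) auto
    moreover have "F' (g x) w = (\<Sum>b\<in>Basis. (w \<bullet> b) *\<^sub>R F' (g x) b)" for w
    proof -
      have "linear (F' (g x))" using F' that assms(3) has_derivative_linear by blast
      then have "F' (g x) (\<Sum>b\<in>Basis. (w \<bullet> b) *\<^sub>R b) = (\<Sum>b\<in>Basis. (w \<bullet> b) *\<^sub>R F' (g x) b)"
        by (simp add: linear_sum linear_cmul)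
      then show ?thesis by (simp add: euclidean_representation)
    qed
    ultimately show ?thesis by (rule has_derivative_eq_rhs[OF _ ext])
  qed
  moreover have "Ck_on k U (\<lambda>x. \<Sum>b\<in>Basis. (g' x v \<bullet> b) *\<^sub>R F' (g x) b)" for v
  proof (intro Ck_on_sum Ck_on_bounded_bilinear[OF bounded_bilinear_scaleR])
    fix b :: 'a
    show "Ck_on k U (\<lambda>x. g' x v \<bullet> b)"
      using g' by (intro Ck_on_compose_bounded_linear[OF bounded_linear_inner_left]) blast
    show "Ck_on k U (\<lambda>x. F' (g x) b)"
      using Suc.IH[of "\<lambda>y. F' y b"] F'(2) Ck_on_Suc_imp[OF Suc.prems(2)] by blast
  qed
  ultimately show ?case by (auto intro!: exI[of _ "\<lambda>x v. \<Sum>b\<in>Basis. (g' x v \<bullet> b) *\<^sub>R F' (g x) b"])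
qed

lemma Ck_on_Suc_real:
  fixes f :: "real \<Rightarrow> 'a::real_normed_vector"
  assumes "\<And>t. t \<in> U \<Longrightarrow> (f has_vector_derivative f' t) (at t)" "Ck_on k U f'"
  shows "Ck_on (Suc k) U f"
  using assms Ck_on_compose_bounded_linear[OF bounded_linear_scaleR_right]
  by (auto simp: has_vector_derivative_def intro!: exI[of _ "\<lambda>x v. v *\<^sub>R f' x"])

lemma Ck_on_sin_cos: "Ck_on k U (\<lambda>t::real. sin t) \<and> Ck_on k U (\<lambda>t::real. cos t)"
proof (induction k)
  case 0
  then show ?case by (auto intro: continuous_intros)
next
  case (Suc k)
  have "Ck_on k U (\<lambda>t. - sin t)"
    using Suc Ck_on_compose_bounded_linear[OF bounded_linear_minus[OF bounded_linear_ident], of k U sin]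
    by simp
  moreover have "((\<lambda>t. sin t) has_vector_derivative cos t) (at t)"
    "((\<lambda>t. cos t) has_vector_derivative - sin t) (at t)" for t :: real
    by (auto simp: has_real_derivative_iff_has_vector_derivative[symmetric] intro!: derivative_eq_intros)
  ultimately show ?case
    using Suc Ck_on_Suc_real[of U sin cos k] Ck_on_Suc_real[of U cos "\<lambda>t. - sin t" k] by simp
qed

section \<open>From C^k maps to smooth maps\<close>

lemma smooth_on_const: "smooth_on U (\<lambda>_. c)"
  by (simp add: smooth_on_def Ck_on_const)

lemma smooth_on_bounded_linear: "bounded_linear h \<Longrightarrow> smooth_on U h"
  by (simp add: smooth_on_def Ck_on_bounded_linear)

lemma smooth_on_compose_bounded_linear:
  "bounded_linear h \<Longrightarrow> smooth_on U f \<Longrightarrow> smooth_on U (\<lambda>x. h (f x))"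
  unfolding smooth_on_def by (intro allI Ck_on_compose_bounded_linear[of h]) blast+

lemma smooth_on_add: "smooth_on U f \<Longrightarrow> smooth_on U g \<Longrightarrow> smooth_on U (\<lambda>x. f x + g x)"
  unfolding smooth_on_def by (intro allI Ck_on_add) auto

lemma smooth_on_bounded_bilinear:
  "bounded_bilinear h \<Longrightarrow> smooth_on U f \<Longrightarrow> smooth_on U g \<Longrightarrow> smooth_on U (\<lambda>x. h (f x) (g x))"
  unfolding smooth_on_def by (intro allI Ck_on_bounded_bilinear[of h]) blast+

lemmas smooth_on_mult = smooth_on_bounded_bilinear[OF bounded_bilinear_mult]
lemmas smooth_on_scaleR = smooth_on_bounded_bilinear[OF bounded_bilinear_scaleR]
lemmas smooth_on_inner = smooth_on_bounded_bilinear[OF bounded_bilinear_inner]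

lemma smooth_on_power:
  fixes f :: "'a::real_normed_vector \<Rightarrow> 'b::real_normed_algebra_1"
  shows "smooth_on U f \<Longrightarrow> smooth_on U (\<lambda>x. f x ^ j)"
  by (induction j) (auto intro: smooth_on_const smooth_on_mult)

lemma smooth_on_compose:
  fixes F :: "'a::euclidean_space \<Rightarrow> 'b::real_normed_vector"
  shows "smooth_on V F \<Longrightarrow> smooth_on U g \<Longrightarrow> g ` U \<subseteq> V \<Longrightarrow> smooth_on U (\<lambda>x. F (g x))"
  using Ck_on_compose[of _ V F U g] unfolding smooth_on_def by simp

lemma smooth_on_subset: "smooth_on U f \<Longrightarrow> V \<subseteq> U \<Longrightarrow> smooth_on V f"
  unfolding smooth_on_def by (intro allI Ck_on_subset[of _ U f V]) blast+

lemma smooth_on_cong: "open U \<Longrightarrow> smooth_on U f \<Longrightarrow> (\<And>x. x \<in> U \<Longrightarrow> f x = g x) \<Longrightarrow> smooth_on U g"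
  using Ck_on_cong[of U _ f g] unfolding smooth_on_def by simp

lemma smooth_on_continuous: "smooth_on U f \<Longrightarrow> continuous_on U f"
  unfolding smooth_on_def using Ck_on.simps(1)[of U f] by simp

lemma smooth_on_has_derivative:
  assumes "smooth_on U f" "x \<in> U"
  shows "(f has_derivative frechet_derivative f (at x)) (at x)"
proof -
  have "Ck_on (Suc 0) U f" using assms(1) by (simp only: smooth_on_def)
  then obtain f' where "(f has_derivative f' x) (at x)" using assms(2) by auto
  then show ?thesis using frechet_derivative_at by metis
qed

text \<open>\<open>smooth_on\<close> provides a separate witness \<open>f'\<close> for each order k;
  uniqueness of the derivative identifies them all with \<open>frechet_derivative\<close>.\<close>

lemma smooth_on_frechet_derivative:
  assumes "smooth_on U f" "open U"
  shows "smooth_on U (\<lambda>x. frechet_derivative f (at x) v)"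
  unfolding smooth_on_def
proof
  fix k
  have "Ck_on (Suc k) U f" using assms(1) by (simp only: smooth_on_def)
  then obtain f' where f': "\<forall>x\<in>U. (f has_derivative f' x) (at x)" "\<forall>v. Ck_on k U (\<lambda>x. f' x v)"
    by auto
  then have "f' x v = frechet_derivative f (at x) v" if "x \<in> U" for x
    using that frechet_derivative_at[of f "f' x" x] by simp
  with f'(2) show "Ck_on k U (\<lambda>x. frechet_derivative f (at x) v)"
    using Ck_on_cong[OF assms(2), of k "\<lambda>x. f' x v"] by simp
qed

section \<open>Second variation by comparison\<close>

lemma smooth_on_chain_rule:
  assumes "smooth_on W f" "c s \<in> W" "(c has_vector_derivative v) (at s)"
  shows "((\<lambda>s. f (c s)) has_vector_derivative frechet_derivative f (at (c s)) v) (at s)"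
  using vector_derivative_diff_chain_within[OF assms(3), of f "frechet_derivative f (at (c s))"]
    smooth_on_has_derivative[OF assms(1,2)] has_derivative_at_withinI
  by (auto simp: o_def)

text \<open>Compactness of [a,b] turns an open condition along the base curve s = 0 into one that
  holds for all small s at once.\<close>

lemma tube_interval:
  fixes W :: "(real \<times> real) set"
  assumes "open W" "{0} \<times> {a..b} \<subseteq> W"
  obtains \<delta> where "\<delta> > 0" "{-\<delta><..<\<delta>} \<times> {a..b} \<subseteq> W"
proof -
  obtain X0 where X0: "0 \<in> X0" "open X0" "X0 \<times> {a..b} \<subseteq> W"
    using Elementary_Topology.tube_lemma[OF _ assms] by auto
  obtain \<delta> where \<delta>: "\<delta> > 0" "ball 0 \<delta> \<subseteq> X0"
    using X0 open_contains_ball by metis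
  have "{-\<delta><..<\<delta>} \<subseteq> ball 0 \<delta>" by (auto simp: dist_real_def)
  with \<delta> X0(3) that[OF \<delta>(1)] show ?thesis by blast
qed

text \<open>Q stands for the squared speed of a variation. Positivity keeps the square root away
  from its singularity, so Leibniz' rule applies twice. Only the existence of l matters later, not
  its value.\<close>

lemma integral_sqrt_twice_differentiable:
  fixes Q :: "real \<times> real \<Rightarrow> real"
  assumes "open W" "smooth_on W Q" "{-\<delta><..<\<delta>} \<times> {a..b} \<subseteq> W" "\<delta> > 0"
    and pos: "\<And>s t. s \<in> {-\<delta><..<\<delta>} \<Longrightarrow> t \<in> {a..b} \<Longrightarrow> Q (s, t) > 0"
  obtains L' l where
    "\<And>s. s \<in> {-\<delta><..<\<delta>} \<Longrightarrow>
       ((\<lambda>s. integral {a..b} (\<lambda>t. sqrt (Q (s, t)))) has_real_derivative L' s) (at s)"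
    "(L' has_real_derivative l) (at 0)"
proof -
  define S where "S = {-\<delta><..<\<delta>}"
  define Q1 where "Q1 = (\<lambda>z. frechet_derivative Q (at z) (1, 0))"
  define Q2 where "Q2 = (\<lambda>z. frechet_derivative Q1 (at z) (1, 0))"
  have sm1: "smooth_on W Q1" unfolding Q1_def by (rule smooth_on_frechet_derivative[OF assms(2,1)])
  have sm2: "smooth_on W Q2" unfolding Q2_def by (rule smooth_on_frechet_derivative[OF sm1 assms(1)])
  have sub: "S \<times> {a..b} \<subseteq> W" using assms(3) S_def by simp
  have line: "((\<lambda>s. (s, t)) has_vector_derivative (1, 0)) (at s)" for s t :: real
    by (auto intro!: derivative_eq_intros)
  have cont: "continuous_on (S \<times> {a..b}) Q" "continuous_on (S \<times> {a..b}) Q1"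
    "continuous_on (S \<times> {a..b}) Q2"
    using smooth_on_continuous[OF assms(2)] smooth_on_continuous[OF sm1] smooth_on_continuous[OF sm2]
      sub continuous_on_subset by blast+
  have contt: "continuous_on {a..b} (\<lambda>t. F (s, t))"
    if "continuous_on (S \<times> {a..b}) F" "s \<in> S" for F :: "real \<times> real \<Rightarrow> real" and s
    using that by (intro continuous_on_compose2[OF that(1)]) (auto intro!: continuous_intros)
  have d0: "((\<lambda>s. Q (s, t)) has_real_derivative Q1 (s, t)) (at s)"
    and d1: "((\<lambda>s. Q1 (s, t)) has_real_derivative Q2 (s, t)) (at s)"
    if "s \<in> S" "t \<in> {a..b}" for s t
    using smooth_on_chain_rule[OF assms(2) _ line, of s t] smooth_on_chain_rule[OF sm1 _ line, of s t]
      that subsetD[OF sub, of "(s, t)"]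
    by (auto simp: has_real_derivative_iff_has_vector_derivative Q1_def Q2_def)
  have Qpos: "Q z > 0" if "z \<in> S \<times> {a..b}" for z using that pos S_def by auto
  have nz: "Q z \<noteq> 0" if "z \<in> S \<times> {a..b}" for z using Qpos[OF that] by simp
  define R1 where "R1 = (\<lambda>s t. Q1 (s, t) / (2 * sqrt (Q (s, t))))"
  define R2 where "R2 = (\<lambda>s t. (Q2 (s, t) * (2 * sqrt (Q (s, t)))
      - Q1 (s, t) * (Q1 (s, t) / sqrt (Q (s, t)))) / (2 * sqrt (Q (s, t)))\<^sup>2)"
  have e0: "((\<lambda>s. sqrt (Q (s, t))) has_real_derivative R1 s t) (at s)"
    if "s \<in> S" "t \<in> {a..b}" for s t
    unfolding R1_def using d0[OF that] Qpos[of "(s, t)"] that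
    by (auto intro!: derivative_eq_intros simp: field_simps)
  have e1: "((\<lambda>s. R1 s t) has_real_derivative R2 s t) (at s)"
    if "s \<in> S" "t \<in> {a..b}" for s t
  proof -
    have p: "sqrt (Q (s, t)) > 0" using Qpos[of "(s, t)"] that by simp
    have "((\<lambda>s. 2 * sqrt (Q (s, t))) has_real_derivative Q1 (s, t) / sqrt (Q (s, t))) (at s)"
      using DERIV_cmult[OF e0[OF that], of 2] by (simp add: R1_def)
    from DERIV_divide[OF d1[OF that] this] p show ?thesis
      unfolding R1_def R2_def by (simp add: power2_eq_square)
  qed
  have csq: "continuous_on (S \<times> {a..b}) (\<lambda>z. sqrt (Q z))"
    using cont(1) by (rule continuous_on_real_sqrt)
  have c2sq: "continuous_on (S \<times> {a..b}) (\<lambda>z. 2 * sqrt (Q z))"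
    using csq by (intro continuous_on_mult continuous_on_const)
  have cR1: "continuous_on (S \<times> {a..b}) (\<lambda>z. Q1 z / (2 * sqrt (Q z)))"
    using nz by (intro continuous_on_divide cont c2sq) auto
  have cR2: "continuous_on (S \<times> {a..b})
      (\<lambda>z. (Q2 z * (2 * sqrt (Q z)) - Q1 z * (Q1 z / sqrt (Q z))) / (2 * sqrt (Q z))\<^sup>2)"
    using nz by (intro continuous_on_divide continuous_on_diff continuous_on_mult continuous_on_power cont c2sq csq) auto
  have cR: "continuous_on (S \<times> {a..b}) (\<lambda>(s, t). R1 s t)" "continuous_on (S \<times> {a..b}) (\<lambda>(s, t). R2 s t)"
    unfolding R1_def R2_def split_beta prod.collapse by (rule cR1, rule cR2)
  have nb: "at s within S = at s" if "s \<in> S" for s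
    using that unfolding S_def by (rule at_within_open) simp
  have L1: "((\<lambda>s. integral {a..b} (\<lambda>t. sqrt (Q (s, t)))) has_real_derivative integral {a..b} (R1 s)) (at s)"
    if "s \<in> S" for s
  proof -
    have "((\<lambda>s. integral (cbox a b) (\<lambda>t. sqrt (Q (s, t)))) has_real_derivative integral (cbox a b) (R1 s))
      (at s within S)"
    proof (rule leibniz_rule_field_derivative)
      show "(\<lambda>t. sqrt (Q (s, t))) integrable_on cbox a b" if "s \<in> S" for s
        using contt[OF cont(1) that] by (auto intro!: integrable_continuous_real continuous_intros)
    qed (use that cR e0 nb in \<open>auto simp: S_def\<close>)
    then show ?thesis using nb[OF that] by simp
  qed
  have 0: "0 \<in> S" using assms(4) S_def by simp
  have L2: "((\<lambda>s. integral {a..b} (R1 s)) has_real_derivative integral {a..b} (R2 0)) (at 0)"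
  proof -
    have "((\<lambda>s. integral (cbox a b) (R1 s)) has_real_derivative integral (cbox a b) (R2 0))
      (at 0 within S)"
    proof (rule leibniz_rule_field_derivative)
      show "R1 s integrable_on cbox a b" if "s \<in> S" for s
        using contt[OF cR(1) that] by (auto intro!: integrable_continuous_real)
    qed (use 0 cR e1 nb in \<open>auto simp: S_def\<close>)
    then show ?thesis using nb[OF 0] by simp
  qed
  show ?thesis by (rule that[OF _ L2]) (rule L1, simp add: S_def)
qed

text \<open>If l were negative, \<open>L'\<close> would be negative just to the right of its zero 0,
  and L would fall below \<open>L 0\<close> there.\<close>

lemma local_min_second_derivative:
  fixes L :: "real \<Rightarrow> real"
  assumes "\<delta> > 0"
    and L': "\<And>s. s \<in> {-\<delta><..<\<delta>} \<Longrightarrow> (L has_real_derivative L' s) (at s)"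
    and l: "(L' has_real_derivative l) (at 0)"
    and min: "\<And>s. s \<in> {-\<delta><..<\<delta>} \<Longrightarrow> L 0 \<le> L s"
  shows "(L has_real_derivative 0) (at 0)" "(deriv ^^ 2) L 0 \<ge> 0"
proof -
  have 0: "(L has_real_derivative L' 0) (at 0)" using assms(1) L' by simp
  have L0: "L' 0 = 0" by (rule DERIV_local_min[OF 0 assms(1)]) (auto intro!: min)
  with 0 show "(L has_real_derivative 0) (at 0)" by simp
  have "(deriv L has_real_derivative l) (at 0)"
    using has_field_derivative_transform_within_open[OF l, of "{-\<delta><..<\<delta>}" "deriv L"] assms(1)
      DERIV_imp_deriv[OF L'] by simp
  then have "(deriv ^^ 2) L 0 = l" by (simp add: numeral_2_eq_2 DERIV_imp_deriv)
  moreover have "l \<ge> 0"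
  proof (rule ccontr)
    assume "\<not> 0 \<le> l"
    then obtain d where d: "d > 0" "\<forall>h>0. h < d \<longrightarrow> L' (0 + h) < L' 0"
      using DERIV_neg_dec_right[OF l] by force
    define s where "s = min d \<delta> / 2"
    have s: "0 < s" "s < d" "s < \<delta>" using d assms(1) unfolding s_def by auto
    have "L s < L 0"
    proof (rule DERIV_neg_imp_decreasing_open[OF s(1)])
      show "\<exists>y. (L has_real_derivative y) (at x) \<and> y < 0" if "0 < x" "x < s" for x
        using that d L0 s L'[of x] by (intro exI[of _ "L' x"]) auto
      show "continuous_on {0..s} L"
        using s L' by (intro DERIV_continuous_on[of _ _ L']) (auto intro: has_field_derivative_at_within)
    qed
    with min[of s] s show False by simp
  qed
  ultimately show "(deriv ^^ 2) L 0 \<ge> 0" by simp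
qed

text \<open>As l > 0, \<open>D'\<close> passes from negative to positive at 0. The radius obtained
  here becomes the opening of the cone around the ray.\<close>

lemma second_derivative_local_min:
  fixes D :: "real \<Rightarrow> real"
  assumes "\<delta> > 0"
    and D': "\<And>y. \<bar>y\<bar> < \<delta> \<Longrightarrow> (D has_real_derivative D' y) (at y)"
    and l: "(D' has_real_derivative l) (at 0)" "D' 0 = 0" "l > 0"
  obtains \<eta> where "\<eta> > 0" "\<eta> \<le> \<delta>" "\<And>y. \<bar>y\<bar> < \<eta> \<Longrightarrow> D 0 \<le> D y"
proof -
  obtain d1 where d1: "d1 > 0" "\<forall>h>0. h < d1 \<longrightarrow> D' 0 < D' (0 + h)"
    using DERIV_pos_inc_right[OF l(1,3)] by blast
  obtain d2 where d2: "d2 > 0" "\<forall>h>0. h < d2 \<longrightarrow> D' (0 - h) < D' 0"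
    using DERIV_pos_inc_left[OF l(1,3)] by blast
  have right: "D' y \<ge> 0" if "0 \<le> y" "y < d1" for y
    using that d1(2)[rule_format, of y] l(2) by (cases "y = 0") auto
  have left: "D' y \<le> 0" if "y \<le> 0" "- y < d2" for y
    using that d2(2)[rule_format, of "- y"] l(2) by (cases "y = 0") auto
  define \<eta> where "\<eta> = min \<delta> (min d1 d2)"
  have "D 0 \<le> D y" if "\<bar>y\<bar> < \<eta>" for y
  proof (cases "y \<ge> 0")
    case True
    show ?thesis
      by (rule DERIV_nonneg_imp_nondecreasing[OF True])
        (metis D' True \<eta>_def abs_of_nonneg le_less_trans min_less_iff_conj right that)
  next
    case False
    then have "y \<le> 0" by simp
    then show ?thesis
    proof (rule DERIV_nonpos_imp_nonincreasing)
      fix x assume x: "y \<le> x" "x \<le> 0"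
      then have "\<bar>x\<bar> < \<delta>" "- x < d2" using that \<eta>_def by auto
      then show "\<exists>z. (D has_real_derivative z) (at x) \<and> z \<le> 0" using D' left x by blast
    qed
  qed
  moreover have "\<eta> > 0" "\<eta> \<le> \<delta>" using d1 d2 assms(1) by (auto simp: \<eta>_def)
  ultimately show ?thesis using that by blast
qed

section \<open>A calibration near the ray\<close>

text \<open>With y = Y/X, the left side is a^p times the squared gradient of the potential divided
  by X^(2n), and the right side is the squared conformal factor on the same scale. Both agree at y =
  0, \<open>H1\<close> makes the logarithmic difference critical there, and \<open>H2\<close> makes
  its second derivative positive.\<close>

lemma calibration_profile:
  fixes t lam h :: real and p m :: nat
  defines "a \<equiv> 1 + lam\<^sup>2 * t\<^sup>2"
  assumes H1: "real p * (lam\<^sup>2 - 1) = real m * a"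
    and H2: "real p * (2 * (t\<^sup>2 + lam\<^sup>2) / a - 4 * t\<^sup>2 * (lam\<^sup>2 - 1)\<^sup>2 / a\<^sup>2) - 2 * real m * t\<^sup>2 > - 2 * h\<^sup>2"
  obtains \<eta> where "\<eta> > 0"
    "\<And>y. \<bar>y\<bar> < \<eta> \<Longrightarrow> a ^ p * ((1 - h\<^sup>2 * y\<^sup>2)\<^sup>2 + h\<^sup>2 * y\<^sup>2)
         \<le> ((1 - t * y)\<^sup>2 + lam\<^sup>2 * (t + y)\<^sup>2) ^ p * (1 - t * y) ^ (2 * m)"
proof -
  have a: "a > 0" unfolding a_def by (simp add: add_pos_nonneg)
  define A where "A = (\<lambda>y. (1 - t * y)\<^sup>2 + lam\<^sup>2 * (t + y)\<^sup>2)"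
  define g where "g = (\<lambda>y. (1 - h\<^sup>2 * y\<^sup>2)\<^sup>2 + h\<^sup>2 * y\<^sup>2)"
  define A' where "A' = (\<lambda>y. - 2 * t * (1 - t * y) + 2 * lam\<^sup>2 * (t + y))"
  define g' where "g' = (\<lambda>y. - 4 * h\<^sup>2 * y * (1 - h\<^sup>2 * y\<^sup>2) + 2 * h\<^sup>2 * y)"
  \<comment> \<open>Logarithms turn the claim into \<open>D 0 \<le> D y\<close>, since
    \<open>D 0\<close> is p ln a.\<close>
  define D where "D = (\<lambda>y. real p * ln (A y) + 2 * real m * ln (1 - t * y) - ln (g y))"
  define D' where "D' = (\<lambda>y. real p * (A' y / A y) - 2 * real m * t / (1 - t * y) - g' y / g y)"
  \<comment> \<open>Within this radius 1 - t y, which is the coordinate r divided by X, stays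
    positive, so that the logarithms are defined.\<close>
  define \<delta> where "\<delta> = 1 / (1 + \<bar>t\<bar>)"
  have \<delta>: "\<delta> > 0" by (simp add: \<delta>_def add_pos_nonneg)
  have p1: "1 - t * y > 0" if "\<bar>y\<bar> < \<delta>" for y
  proof -
    have "t * y \<le> \<bar>t\<bar> * \<bar>y\<bar>" by (metis abs_ge_self abs_mult)
    also have "\<dots> \<le> \<bar>t\<bar> * \<delta>" using that by (simp add: mult_left_mono)
    also have "\<dots> < 1" unfolding \<delta>_def by (simp add: field_simps add_pos_nonneg)
    finally show ?thesis by simp
  qed
  then have Apos: "A y > 0" if "\<bar>y\<bar> < \<delta>" for y
    using that unfolding A_def by (metis add_pos_nonneg zero_less_power mult_nonneg_nonneg zero_le_power2)
  have gpos: "g y > 0" for y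
  proof (cases "h * y = 0")
    case False
    then have "h\<^sup>2 * y\<^sup>2 > 0" by (simp flip: power_mult_distrib)
    then show ?thesis unfolding g_def by (simp add: add_nonneg_pos)
  qed (auto simp: g_def)
  have dA: "(A has_real_derivative A' y) (at y)" and dg: "(g has_real_derivative g' y) (at y)" for y
    unfolding A_def A'_def g_def g'_def
    by (auto intro!: derivative_eq_intros simp: algebra_simps power2_eq_square)
  have dD: "(D has_real_derivative D' y) (at y)" if "\<bar>y\<bar> < \<delta>" for y
    unfolding D_def D'_def using p1[OF that] Apos[OF that] gpos[of y]
    by (auto intro!: derivative_eq_intros dA dg simp: field_simps)
  have val: "A 0 = a" "g 0 = 1" "A' 0 = 2 * t * (lam\<^sup>2 - 1)" "g' 0 = 0"
    by (auto simp: A_def g_def A'_def g'_def a_def algebra_simps)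
  \<comment> \<open>The geodesic condition: the logarithm of the conformal factor has no normal
    derivative along the ray.\<close>
  have "D' 0 = 2 * t * (real p * (lam\<^sup>2 - 1) - real m * a) / a"
    unfolding D'_def val using a by (simp add: field_simps)
  then have D0: "D' 0 = 0" by (simp add: H1)
  have dA': "(A' has_real_derivative 2 * (t\<^sup>2 + lam\<^sup>2)) (at 0)"
    and dg': "(g' has_real_derivative - 2 * h\<^sup>2) (at 0)"
    unfolding A'_def g'_def by (auto intro!: derivative_eq_intros simp: algebra_simps power2_eq_square)
  define l where "l = real p * (2 * (t\<^sup>2 + lam\<^sup>2) / a - 4 * t\<^sup>2 * (lam\<^sup>2 - 1)\<^sup>2 / a\<^sup>2) - 2 * real m * t\<^sup>2 + 2 * h\<^sup>2"
  have q1: "((\<lambda>y. A' y / A y) has_real_derivative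
      2 * (t\<^sup>2 + lam\<^sup>2) / a - 4 * t\<^sup>2 * (lam\<^sup>2 - 1)\<^sup>2 / a\<^sup>2) (at 0)"
    by (rule DERIV_cong[OF DERIV_divide[OF dA' dA]])
      (use a in \<open>simp_all add: val diff_divide_distrib power2_eq_square\<close>)
  have q2: "((\<lambda>y. g' y / g y) has_real_derivative - 2 * h\<^sup>2) (at 0)"
    using DERIV_divide[OF dg' dg] unfolding val by simp
  have q3: "((\<lambda>y. 2 * real m * t / (1 - t * y)) has_real_derivative 2 * real m * t\<^sup>2) (at 0)"
    by (auto intro!: derivative_eq_intros simp: power2_eq_square)
  have dD': "(D' has_real_derivative l) (at 0)"
    unfolding D'_def l_def
    by (rule DERIV_cong[OF DERIV_diff[OF DERIV_diff[OF DERIV_cmult[OF q1] q3] q2]]) simp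
  have "l > 0" using H2 l_def by simp
  then obtain \<eta> where \<eta>: "\<eta> > 0" "\<eta> \<le> \<delta>" "\<And>y. \<bar>y\<bar> < \<eta> \<Longrightarrow> D 0 \<le> D y"
    using second_derivative_local_min[OF \<delta> dD dD' D0] by blast
  have "a ^ p * g y \<le> A y ^ p * (1 - t * y) ^ (2 * m)" if "\<bar>y\<bar> < \<eta>" for y
  proof -
    have y: "\<bar>y\<bar> < \<delta>" using that \<eta> by simp
    have "ln (a ^ p * g y) = D 0 + ln (g y)"
      using a gpos[of y] by (simp add: ln_mult ln_realpow D_def val)
    also have "\<dots> \<le> D y + ln (g y)" using \<eta>(3)[OF that] by simp
    also have "\<dots> = ln (A y ^ p * (1 - t * y) ^ (2 * m))"
      using Apos[OF y] p1[OF y] by (simp add: ln_mult ln_realpow D_def)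
    finally show ?thesis using a gpos[of y] Apos[OF y] p1[OF y] by simp
  qed
  then show ?thesis using that[OF \<eta>(1)] unfolding A_def g_def by blast
qed

text \<open>The left side is a multiple of du applied to the velocity (dX, dY), the right side the
  length element in the coordinates r = X - t Y, rho = t X + Y. Cauchy-Schwarz reduces the claim to
  the norm of the gradient, and homogeneity reduces that to \<open>prof\<close>.\<close>

lemma calibration_bound:
  fixes X Y dX dY t lam h \<sigma> :: real and n p :: nat
  defines "a \<equiv> 1 + lam\<^sup>2 * t\<^sup>2"
  assumes "X > 0" "p \<le> n" "n \<ge> 2"
    and prof: "a ^ p * ((1 - h\<^sup>2 * (Y / X)\<^sup>2)\<^sup>2 + h\<^sup>2 * (Y / X)\<^sup>2)
      \<le> ((1 - t * (Y / X))\<^sup>2 + lam\<^sup>2 * (t + Y / X)\<^sup>2) ^ p * (1 - t * (Y / X)) ^ (2 * (n - p))"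
  shows "\<sigma> * sqrt ((1 + t\<^sup>2) * a ^ p) * ((X ^ n - h\<^sup>2 * X ^ (n - 2) * Y\<^sup>2) * dX - h * X ^ (n - 1) * Y * dY)
    \<le> sqrt (\<sigma>\<^sup>2 * ((X - t * Y)\<^sup>2 + lam\<^sup>2 * (t * X + Y)\<^sup>2) ^ p * (X - t * Y) ^ (2 * (n - p))
         * ((dX - t * dY)\<^sup>2 + (t * dX + dY)\<^sup>2))"
proof (rule real_le_rsqrt)
  define w where "w = Y / X"
  have Y: "Y = X * w" using assms by (simp add: w_def)
  have a: "a > 0" unfolding a_def by (simp add: add_pos_nonneg)
  \<comment> \<open>\<open>n \<ge> 2\<close> makes the subtractions in the exponents
    genuine.\<close>
  have X2: "X ^ (n - 2) * X\<^sup>2 = X ^ n" and X1: "X ^ (n - 1) * X = X ^ n"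
    using assms(4) by (metis le_add_diff_inverse2 power_add, intro power_minus_mult, simp)
  have u: "(X ^ n - h\<^sup>2 * X ^ (n - 2) * Y\<^sup>2) * dX - h * X ^ (n - 1) * Y * dY
     = X ^ n * ((1 - h\<^sup>2 * w\<^sup>2) * dX - h * w * dY)"
  proof -
    have 1: "h\<^sup>2 * X ^ (n - 2) * Y\<^sup>2 = X ^ n * (h\<^sup>2 * w\<^sup>2)"
      by (simp only: Y X2[symmetric] power_mult_distrib ac_simps)
    have 2: "h * X ^ (n - 1) * Y = X ^ n * (h * w)"
      by (simp only: Y X1[symmetric] ac_simps)
    show ?thesis unfolding 1 2 by (simp only: algebra_simps)
  qed
  \<comment> \<open>Cauchy-Schwarz in the plane, with Lagrange's identity giving the defect as a
    square.\<close>
  have cs: "((1 - h\<^sup>2 * w\<^sup>2) * dX - h * w * dY)\<^sup>2 \<le> ((1 - h\<^sup>2 * w\<^sup>2)\<^sup>2 + h\<^sup>2 * w\<^sup>2) * (dX\<^sup>2 + dY\<^sup>2)"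
  proof -
    have "((1 - h\<^sup>2 * w\<^sup>2)\<^sup>2 + h\<^sup>2 * w\<^sup>2) * (dX\<^sup>2 + dY\<^sup>2) - ((1 - h\<^sup>2 * w\<^sup>2) * dX - h * w * dY)\<^sup>2
      = ((1 - h\<^sup>2 * w\<^sup>2) * dY + h * w * dX)\<^sup>2" by (simp add: power2_eq_square algebra_simps)
    then show ?thesis by (metis diff_ge_0_iff_ge zero_le_power2)
  qed
  have "(\<sigma> * sqrt ((1 + t\<^sup>2) * a ^ p) * (X ^ n * ((1 - h\<^sup>2 * w\<^sup>2) * dX - h * w * dY)))\<^sup>2
     = \<sigma>\<^sup>2 * (1 + t\<^sup>2) * (X ^ n)\<^sup>2 * a ^ p * ((1 - h\<^sup>2 * w\<^sup>2) * dX - h * w * dY)\<^sup>2"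
    using a by (simp add: power_mult_distrib)
  also have "\<dots> \<le> \<sigma>\<^sup>2 * (1 + t\<^sup>2) * (X ^ n)\<^sup>2 * a ^ p * (((1 - h\<^sup>2 * w\<^sup>2)\<^sup>2 + h\<^sup>2 * w\<^sup>2) * (dX\<^sup>2 + dY\<^sup>2))"
    using cs a by (intro mult_left_mono) auto
  also have "\<dots> = \<sigma>\<^sup>2 * (1 + t\<^sup>2) * (X ^ n)\<^sup>2 * (dX\<^sup>2 + dY\<^sup>2) * (a ^ p * ((1 - h\<^sup>2 * w\<^sup>2)\<^sup>2 + h\<^sup>2 * w\<^sup>2))"
    by (simp add: ac_simps)
  also have "\<dots> \<le> \<sigma>\<^sup>2 * (1 + t\<^sup>2) * (X ^ n)\<^sup>2 * (dX\<^sup>2 + dY\<^sup>2) *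
      (((1 - t * w)\<^sup>2 + lam\<^sup>2 * (t + w)\<^sup>2) ^ p * (1 - t * w) ^ (2 * (n - p)))"
    using prof unfolding w_def by (intro mult_left_mono) auto
  also have "\<dots> = \<sigma>\<^sup>2 * ((X - t * Y)\<^sup>2 + lam\<^sup>2 * (t * X + Y)\<^sup>2) ^ p * (X - t * Y) ^ (2 * (n - p))
         * ((dX - t * dY)\<^sup>2 + (t * dX + dY)\<^sup>2)"
  proof -
    have 1: "X - t * Y = X * (1 - t * w)" "t * X + Y = X * (t + w)" by (simp_all add: Y algebra_simps)
    have 2: "(dX - t * dY)\<^sup>2 + (t * dX + dY)\<^sup>2 = (1 + t\<^sup>2) * (dX\<^sup>2 + dY\<^sup>2)"
      by (simp add: power2_eq_square algebra_simps)
    have 3: "(X * (1 - t * w))\<^sup>2 + lam\<^sup>2 * (X * (t + w))\<^sup>2 = X\<^sup>2 * ((1 - t * w)\<^sup>2 + lam\<^sup>2 * (t + w)\<^sup>2)"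
      by (simp add: power2_eq_square algebra_simps)
    \<comment> \<open>The conformal factor squared has total degree 2 p + 2 (n - p), which is 2 n
      because \<open>p \<le> n\<close>.\<close>
    have 4: "(X ^ n)\<^sup>2 = (X\<^sup>2) ^ p * X ^ (2 * (n - p))"
    proof -
      have "n * 2 = 2 * p + 2 * (n - p)" using assms(3) by simp
      then show ?thesis by (simp only: power_add[symmetric] power_mult[symmetric])
    qed
    show ?thesis
      unfolding 1 2 3 4 power_mult_distrib[of "X\<^sup>2" _ p] power_mult_distrib[of X _ "2 * (n - p)"]
      by (simp only: ac_simps)
  qed
  finally show "(\<sigma> * sqrt ((1 + t\<^sup>2) * a ^ p) *
      ((X ^ n - h\<^sup>2 * X ^ (n - 2) * Y\<^sup>2) * dX - h * X ^ (n - 1) * Y * dY))\<^sup>2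
    \<le> \<sigma>\<^sup>2 * ((X - t * Y)\<^sup>2 + lam\<^sup>2 * (t * X + Y)\<^sup>2) ^ p * (X - t * Y) ^ (2 * (n - p))
         * ((dX - t * dY)\<^sup>2 + (t * dX + dY)\<^sup>2)" unfolding u .
qed

section \<open>Lengths of variations of the LOC segment\<close>

lemma unit_sphere_vol_pos: "unit_sphere_vol n > 0"
  by (simp add: unit_sphere_vol_def)

lemma bounded_linear_LOC_curve: "bounded_linear (LOC_curve \<theta>)"
  unfolding LOC_curve_def[abs_def]
  by (intro bounded_linear_Pair bounded_linear_ident bounded_linear_mult_right)

lemma interior_Ioc_01: "interior {0<..1::real} = {0<..<1}"
  by simp

text \<open>The calibration argument: for small s the length of \<open>\<Gamma> s\<close> over [a,b]
  is at least the difference of the potential at the end points, with equality at s = 0. The end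
  points stay fixed, so s = 0 is a local minimum of L.\<close>

lemma LOC_variation_comparison:
  fixes lam \<theta> :: real and n p :: nat and \<Gamma> :: "real \<Rightarrow> real \<Rightarrow> real \<times> real"
  defines "t \<equiv> tan \<theta>"
  defines "a0 \<equiv> 1 + lam\<^sup>2 * t\<^sup>2"
  defines "h \<equiv> (real n - 1) / 2"
  assumes "p \<le> n" "n \<ge> 2"
    and H1: "real p * (lam\<^sup>2 - 1) = real (n - p) * a0"
    and H2: "real p * (2 * (t\<^sup>2 + lam\<^sup>2) / a0 - 4 * t\<^sup>2 * (lam\<^sup>2 - 1)\<^sup>2 / a0\<^sup>2)
      - 2 * real (n - p) * t\<^sup>2 > - 2 * h\<^sup>2"
    and \<Gamma>: "compact_variation quotient_space {0<..1} (LOC_curve \<theta>) a b \<Gamma>"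
  defines "L \<equiv> \<lambda>s. curve_length (quotient_metric n p lam) a b (\<Gamma> s)"
  shows "(L has_real_derivative 0) (at 0)" "(deriv ^^ 2) L 0 \<ge> 0"
proof -
  define \<sigma> where "\<sigma> = unit_sphere_vol n"
  have \<sigma>: "\<sigma> > 0" by (simp add: \<sigma>_def unit_sphere_vol_pos)
  have a0: "a0 > 0" unfolding a0_def by (simp add: add_pos_nonneg)
  define q where "q = 1 + t\<^sup>2"
  have q: "q > 0" unfolding q_def by (simp add: add_pos_nonneg)
  from \<Gamma> obtain \<epsilon> where ab: "a < b" "{a..b} \<subseteq> {0<..<1}" and \<epsilon>: "\<epsilon> > 0"
    and sm: "smooth_on ({-\<epsilon><..<\<epsilon>} \<times> {0<..<1}) (\<lambda>(s, \<tau>). \<Gamma> s \<tau>)"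
    and \<Gamma>0: "\<And>\<tau>. \<tau> \<in> {0<..<1} \<Longrightarrow> \<Gamma> 0 \<tau> = LOC_curve \<theta> \<tau>"
    and \<Gamma>N: "\<And>s \<tau>. s \<in> {-\<epsilon><..<\<epsilon>} \<Longrightarrow> \<tau> \<in> {0<..<1} \<Longrightarrow> \<Gamma> s \<tau> \<in> quotient_space"
    and \<Gamma>out: "\<And>s \<tau>. s \<in> {-\<epsilon><..<\<epsilon>} \<Longrightarrow> \<tau> \<in> {0<..<1} \<Longrightarrow> \<tau> \<notin> {a..b} \<Longrightarrow> \<Gamma> s \<tau> = LOC_curve \<theta> \<tau>"
    unfolding compact_variation_def interior_Ioc_01 by blast
  define W where "W = {-\<epsilon><..<\<epsilon>} \<times> {0<..<1::real}"
  define G where "G = (\<lambda>(s, \<tau>). \<Gamma> s \<tau>)"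
  \<comment> \<open>The velocity as one function of (s, \<tau>), so that the squared speed is
    visibly smooth in both variables.\<close>
  define Gt where "Gt = (\<lambda>z. frechet_derivative G (at z) (0, 1))"
  have W: "open W" by (simp add: W_def open_Times)
  have smG: "smooth_on W G" using sm by (simp add: W_def G_def)
  have smGt: "smooth_on W Gt" unfolding Gt_def by (rule smooth_on_frechet_derivative[OF smG W])
  have G: "G (s, \<tau>) = \<Gamma> s \<tau>" for s \<tau> by (simp add: G_def)
  have line: "(Pair s has_vector_derivative (0, 1)) (at \<tau>)" for s \<tau> :: real
    by (auto intro!: derivative_eq_intros)
  have dG: "(\<Gamma> s has_vector_derivative Gt (s, \<tau>)) (at \<tau>)" if "(s, \<tau>) \<in> W" for s \<tau>
    using smooth_on_chain_rule[OF smG _ line[of s \<tau>]] that by (simp add: Gt_def G)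
  define Q where "Q = (\<lambda>z. \<sigma>\<^sup>2 * ((fst (G z))\<^sup>2 + lam\<^sup>2 * (snd (G z))\<^sup>2) ^ p * fst (G z) ^ (2 * (n - p))
      * (Gt z \<bullet> Gt z))"
  have smfst: "smooth_on W (\<lambda>z. fst (G z))" "smooth_on W (\<lambda>z. snd (G z))"
    by (intro smooth_on_compose_bounded_linear[OF _ smG] bounded_linear_fst bounded_linear_snd)+
  have smQ: "smooth_on W Q" unfolding Q_def
    by (intro smooth_on_mult smooth_on_inner smooth_on_power smooth_on_add smooth_on_const smfst smGt)
  have Q: "quotient_metric n p lam (\<Gamma> s \<tau>) (vector_derivative (\<Gamma> s) (at \<tau>)) (vector_derivative (\<Gamma> s) (at \<tau>))
      = Q (s, \<tau>)" if "(s, \<tau>) \<in> W" for s \<tau>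
    unfolding quotient_metric_def Q_def vector_derivative_at[OF dG[OF that]] G \<sigma>_def
    by (simp add: split_beta)
  have LQ: "L s = integral {a..b} (\<lambda>\<tau>. sqrt (Q (s, \<tau>)))" if "s \<in> {-\<epsilon><..<\<epsilon>}" for s
    unfolding L_def curve_length_def using that ab Q W_def
    by (intro Henstock_Kurzweil_Integration.integral_cong) (simp add: subset_iff)
  obtain \<eta> where \<eta>: "\<eta> > 0" "\<And>y. \<bar>y\<bar> < \<eta> \<Longrightarrow> a0 ^ p * ((1 - h\<^sup>2 * y\<^sup>2)\<^sup>2 + h\<^sup>2 * y\<^sup>2)
         \<le> ((1 - t * y)\<^sup>2 + lam\<^sup>2 * (t + y)\<^sup>2) ^ p * (1 - t * y) ^ (2 * (n - p))"
    using calibration_profile[OF H1[unfolded a0_def] H2[unfolded a0_def]] unfolding a0_def by metis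
  \<comment> \<open>The inverse of the linear change of coordinates r = X - t Y, rho = t X + Y,
    whose determinant is q.\<close>
  define X where "X = (\<lambda>z. (fst (G z) + t * snd (G z)) / q)"
  define Y where "Y = (\<lambda>z. (snd (G z) - t * fst (G z)) / q)"
  define dX where "dX = (\<lambda>z. (fst (Gt z) + t * snd (Gt z)) / q)"
  define dY where "dY = (\<lambda>z. (snd (Gt z) - t * fst (Gt z)) / q)"
  have XY: "fst (G z) = X z - t * Y z" "snd (G z) = t * X z + Y z"
    "fst (Gt z) = dX z - t * dY z" "snd (Gt z) = t * dX z + dY z" for z
    using q unfolding X_def Y_def dX_def dY_def
    by (simp_all add: field_simps) (simp_all add: q_def power2_eq_square algebra_simps)
  have QXY: "Q z = \<sigma>\<^sup>2 * ((X z - t * Y z)\<^sup>2 + lam\<^sup>2 * (t * X z + Y z)\<^sup>2) ^ p * (X z - t * Y z) ^ (2 * (n - p))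
         * ((dX z - t * dY z)\<^sup>2 + (t * dX z + dY z)\<^sup>2)" for z
    unfolding Q_def XY[symmetric] by (simp add: inner_prod_def power2_eq_square)
  have base: "X (0, \<tau>) = \<tau>" "Y (0, \<tau>) = 0" "dX (0, \<tau>) = 1" "dY (0, \<tau>) = 0" if "\<tau> \<in> {0<..<1}" for \<tau>
  proof -
    have g: "G (0, \<tau>) = (\<tau>, t * \<tau>)" using \<Gamma>0[OF that] by (simp add: G LOC_curve_def t_def)
    have "(\<Gamma> 0 has_vector_derivative (1, t)) (at \<tau>)"
    proof (rule has_vector_derivative_transform_within_open[of "LOC_curve \<theta>" _ _ "{0<..<1}"])
      show "(LOC_curve \<theta> has_vector_derivative (1, t)) (at \<tau>)"
        using bounded_linear_imp_has_derivative[OF bounded_linear_LOC_curve, of \<theta>]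
        by (simp add: has_vector_derivative_def LOC_curve_def[abs_def] t_def mult.commute)
    qed (use that \<Gamma>0 in auto)
    then have "Gt (0, \<tau>) = (1, t)"
      using dG[of 0 \<tau>] that \<epsilon> vector_derivative_unique_at by (auto simp: W_def)
    with g show "X (0, \<tau>) = \<tau>" "Y (0, \<tau>) = 0" "dX (0, \<tau>) = 1" "dY (0, \<tau>) = 0"
      using q unfolding X_def Y_def dX_def dY_def
      by (simp_all add: field_simps) (simp_all add: q_def power2_eq_square algebra_simps)
  qed
  \<comment> \<open>The normalisation that makes du equal to the length element on the ray, where
    the speed is \<open>K * \<tau> ^ n\<close>.\<close>
  define K where "K = \<sigma> * sqrt (q * a0 ^ p)"
  have Q0: "Q (0, \<tau>) = (K * \<tau> ^ n)\<^sup>2" if "\<tau> \<in> {0<..<1}" for \<tau>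
  proof -
    have "\<tau>\<^sup>2 + lam\<^sup>2 * (t * \<tau>)\<^sup>2 = a0 * \<tau>\<^sup>2"
      by (simp add: a0_def power_mult_distrib algebra_simps)
    moreover have "(\<tau>\<^sup>2) ^ p * \<tau> ^ (2 * (n - p)) = (\<tau> ^ n)\<^sup>2"
    proof -
      have "n * 2 = 2 * p + 2 * (n - p)" using \<open>p \<le> n\<close> by simp
      then show ?thesis by (simp only: power_add[symmetric] power_mult[symmetric])
    qed
    ultimately show ?thesis
      unfolding QXY base[OF that] K_def using a0 q
      by (simp add: power_mult_distrib q_def mult_ac)
  qed
  have cont: "continuous_on W Q" "continuous_on W X" "continuous_on W Y"
    unfolding X_def Y_def using q
    by (intro smooth_on_continuous[OF smQ] continuous_intros smooth_on_continuous[OF smfst(1)]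
        smooth_on_continuous[OF smfst(2)]; simp)+
  \<comment> \<open>Three strict inequalities in one open preimage: positive squared speed for
    differentiability of the length, X > 0, and membership in the cone
    \<open>\<bar>Y\<bar> < \<eta> * X\<close> where the profile estimate holds.\<close>
  define O1 where "O1 = W \<inter> (\<lambda>z. min (Q z) (min (X z) (\<eta> * X z - \<bar>Y z\<bar>))) -` {0<..}"
  have "open O1" unfolding O1_def
    by (intro continuous_open_preimage continuous_on_min cont continuous_on_diff continuous_on_mult
        continuous_on_const continuous_on_rabs W) auto
  moreover have "{0} \<times> {a..b} \<subseteq> O1"
  proof clarify
    fix \<tau> assume "\<tau> \<in> {a..b}"
    then have \<tau>: "\<tau> \<in> {0<..<1}" using ab by blast
    moreover have "(K * \<tau> ^ n)\<^sup>2 > 0" using \<sigma> q a0 \<tau> by (simp add: K_def)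
    ultimately show "(0, \<tau>) \<in> O1"
      using \<eta>(1) \<epsilon> unfolding O1_def W_def by (simp add: Q0[OF \<tau>] base[OF \<tau>])
  qed
  ultimately obtain \<delta> where \<delta>: "\<delta> > 0" "{-\<delta><..<\<delta>} \<times> {a..b} \<subseteq> O1"
    by (rule tube_interval)
  have tube: "(s, \<tau>) \<in> W" "Q (s, \<tau>) > 0" "X (s, \<tau>) > 0" "\<bar>Y (s, \<tau>)\<bar> < \<eta> * X (s, \<tau>)"
    if "s \<in> {-\<delta><..<\<delta>}" "\<tau> \<in> {a..b}" for s \<tau>
    using subsetD[OF \<delta>(2), of "(s, \<tau>)"] that by (auto simp: O1_def)
  have \<delta>\<epsilon>: "s \<in> {-\<epsilon><..<\<epsilon>}" if "s \<in> {-\<delta><..<\<delta>}" for s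
    using tube(1)[OF that, of a] ab(1) by (simp add: W_def)
  have tubesub: "{-\<delta><..<\<delta>} \<times> {a..b} \<subseteq> W" using tube(1) by auto
  \<comment> \<open>The potential pulled back to the variation. It depends on (s, \<tau>) through
    \<open>G\<close> alone, so fixed end points mean fixed boundary values.\<close>
  define u where "u = (\<lambda>z. K * (X z ^ (n + 1) / (n + 1) - h / 2 * X z ^ (n - 1) * (Y z)\<^sup>2))"
  define du where "du = (\<lambda>z. K * ((X z ^ n - h\<^sup>2 * X z ^ (n - 2) * (Y z)\<^sup>2) * dX z
      - h * X z ^ (n - 1) * Y z * dY z))"
  have du: "((\<lambda>\<tau>. u (s, \<tau>)) has_real_derivative du (s, \<tau>)) (at \<tau>)" if "(s, \<tau>) \<in> W" for s \<tau>
  proof -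
    have 1: "((\<lambda>\<tau>. fst (G (s, \<tau>))) has_real_derivative fst (Gt (s, \<tau>))) (at \<tau>)"
      "((\<lambda>\<tau>. snd (G (s, \<tau>))) has_real_derivative snd (Gt (s, \<tau>))) (at \<tau>)"
      unfolding has_real_derivative_iff_has_vector_derivative G
      using bounded_linear.has_vector_derivative[OF bounded_linear_fst dG[OF that]]
        bounded_linear.has_vector_derivative[OF bounded_linear_snd dG[OF that]] by simp_all
    have dx: "((\<lambda>\<tau>. X (s, \<tau>)) has_real_derivative dX (s, \<tau>)) (at \<tau>)"
      and dy: "((\<lambda>\<tau>. Y (s, \<tau>)) has_real_derivative dY (s, \<tau>)) (at \<tau>)"
      unfolding X_def Y_def dX_def dY_def
      by (intro DERIV_cdivide DERIV_add DERIV_diff DERIV_cmult 1)+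
    \<comment> \<open>This removes truncated subtraction from the exponents. Then \<open>h\<close>
      is (j + 1)/2, and differentiating X^(n-1) in the second term of \<open>u\<close> produces the
      coefficient h (n - 1)/2 = h^2.\<close>
    obtain j where n: "n = Suc (Suc j)" using \<open>n \<ge> 2\<close> by (metis add_2_eq_Suc le_Suc_ex)
    have h: "h = (real j + 1) / 2" by (simp add: h_def n)
    show ?thesis unfolding u_def du_def n
      by (rule derivative_eq_intros dx dy refl | simp)+
        (simp add: h field_simps power2_eq_square)
  qed
  \<comment> \<open>Integrate the pointwise bound on du; the fundamental theorem of calculus leaves
    only boundary values.\<close>
  have lower: "L s \<ge> u (s, b) - u (s, a) \<and> (s = 0 \<longrightarrow> L s = u (s, b) - u (s, a))"
    if s: "s \<in> {-\<delta><..<\<delta>}" for s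
  proof -
    have ftc: "((\<lambda>\<tau>. du (s, \<tau>)) has_integral (u (s, b) - u (s, a))) {a..b}"
      using ab(1) du tube(1)[OF s]
      by (intro fundamental_theorem_of_calculus)
        (auto simp: has_real_derivative_iff_has_vector_derivative[symmetric]
          intro: has_field_derivative_at_within)
    have "continuous_on {a..b} (\<lambda>\<tau>. Q (s, \<tau>))"
      using tube(1)[OF s] by (intro continuous_on_compose2[OF cont(1)]) (auto intro!: continuous_intros)
    then have int: "(\<lambda>\<tau>. sqrt (Q (s, \<tau>))) integrable_on {a..b}"
      by (intro integrable_continuous_real continuous_on_real_sqrt)
    have "du (s, \<tau>) \<le> sqrt (Q (s, \<tau>))" if \<tau>: "\<tau> \<in> {a..b}" for \<tau>
    proof -
      note T = tube[OF s \<tau>]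
      have "\<bar>Y (s, \<tau>) / X (s, \<tau>)\<bar> < \<eta>" using T(3,4) by (simp add: field_simps)
      from calibration_bound[OF T(3) \<open>p \<le> n\<close> \<open>n \<ge> 2\<close>, of lam t h "Y (s, \<tau>)" \<sigma> "dX (s, \<tau>)" "dY (s, \<tau>)"]
        \<eta>(2)[OF this]
      show ?thesis unfolding du_def QXY K_def q_def a0_def by (simp add: mult.assoc)
    qed
    then have 1: "L s \<ge> u (s, b) - u (s, a)"
      using has_integral_le[OF ftc integrable_integral[OF int]] LQ[OF \<delta>\<epsilon>[OF s]] by simp
    have 2: "L s = u (s, b) - u (s, a)" if "s = 0"
    proof -
      have "du (s, \<tau>) = sqrt (Q (s, \<tau>))" if "\<tau> \<in> {a..b}" for \<tau>
      proof -
        have "\<tau> \<in> {0<..<1}" using that ab by blast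
        moreover have "K > 0" using \<sigma> q a0 by (simp add: K_def)
        ultimately show ?thesis unfolding \<open>s = 0\<close> du_def by (simp add: base Q0)
      qed
      from has_integral_eq[OF this ftc] show ?thesis using LQ[OF \<delta>\<epsilon>[OF s]] by (simp add: integral_unique)
    qed
    from 1 2 show ?thesis by blast
  qed
  \<comment> \<open>The variation is prescribed only outside the closed interval [a,b], so its
    values at a and b are one-sided limits from outside.\<close>
  have ends: "\<Gamma> s a = LOC_curve \<theta> a" "\<Gamma> s b = LOC_curve \<theta> b" if "s \<in> {-\<epsilon><..<\<epsilon>}" for s
  proof -
    have c1: "continuous_on {0<..<1} (\<Gamma> s)"
      using dG that by (intro continuous_at_imp_continuous_on ballI has_vector_derivative_continuous)
        (auto simp: W_def)
    have c2: "continuous_on {0<..<1} (LOC_curve \<theta>)"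
      using bounded_linear_LOC_curve linear_continuous_on by blast
    have ab01: "0 < a" "b < 1" using ab(1) subsetD[OF ab(2), of a] subsetD[OF ab(2), of b] by auto
    have "isCont (\<Gamma> s) a" "isCont (LOC_curve \<theta>) a" "isCont (\<Gamma> s) b" "isCont (LOC_curve \<theta>) b"
      using c1 c2 ab ab01 by (auto simp: continuous_on_eq_continuous_at)
    show "\<Gamma> s a = LOC_curve \<theta> a"
    proof (rule tendsto_unique[of "at_left a"])
      show "(\<Gamma> s \<longlongrightarrow> \<Gamma> s a) (at_left a)" using \<open>isCont (\<Gamma> s) a\<close>
        by (simp add: isCont_def filterlim_at_split)
      have "(LOC_curve \<theta> \<longlongrightarrow> LOC_curve \<theta> a) (at_left a)" using \<open>isCont (LOC_curve \<theta>) a\<close>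
        by (simp add: isCont_def filterlim_at_split)
      moreover have "eventually (\<lambda>\<tau>. LOC_curve \<theta> \<tau> = \<Gamma> s \<tau>) (at_left a)"
        using ab01 ab(1) that by (intro eventually_at_leftI[of 0]) (auto simp: \<Gamma>out)
      ultimately show "(\<Gamma> s \<longlongrightarrow> LOC_curve \<theta> a) (at_left a)" by (rule Lim_transform_eventually)
    qed simp
    show "\<Gamma> s b = LOC_curve \<theta> b"
    proof (rule tendsto_unique[of "at_right b"])
      show "(\<Gamma> s \<longlongrightarrow> \<Gamma> s b) (at_right b)" using \<open>isCont (\<Gamma> s) b\<close>
        by (simp add: isCont_def filterlim_at_split)
      have "(LOC_curve \<theta> \<longlongrightarrow> LOC_curve \<theta> b) (at_right b)" using \<open>isCont (LOC_curve \<theta>) b\<close>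
        by (simp add: isCont_def filterlim_at_split)
      moreover have "eventually (\<lambda>\<tau>. LOC_curve \<theta> \<tau> = \<Gamma> s \<tau>) (at_right b)"
        using ab01 ab(1) that by (intro eventually_at_rightI[of _ 1]) (auto simp: \<Gamma>out)
      ultimately show "(\<Gamma> s \<longlongrightarrow> LOC_curve \<theta> b) (at_right b)" by (rule Lim_transform_eventually)
    qed simp
  qed
  have min: "L 0 \<le> L s" if s: "s \<in> {-\<delta><..<\<delta>}" for s
  proof -
    have 0: "0 \<in> {-\<delta><..<\<delta>}" using \<delta>(1) by simp
    have "G (s, a) = G (0, a)" "G (s, b) = G (0, b)"
      using ends[OF \<delta>\<epsilon>[OF s]] ends[OF \<delta>\<epsilon>[OF 0]] by (simp_all add: G)
    then have "u (s, a) = u (0, a)" "u (s, b) = u (0, b)" by (simp_all add: u_def X_def Y_def)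
    then show ?thesis using lower[OF s] lower[OF 0] by simp
  qed
  obtain L' l where L': "\<And>s. s \<in> {-\<delta><..<\<delta>} \<Longrightarrow>
       ((\<lambda>s. integral {a..b} (\<lambda>t. sqrt (Q (s, t)))) has_real_derivative L' s) (at s)"
    and l: "(L' has_real_derivative l) (at 0)"
    using integral_sqrt_twice_differentiable[OF W smQ tubesub \<delta>(1) tube(2)] by blast
  have "(L has_real_derivative L' s) (at s)" if "s \<in> {-\<delta><..<\<delta>}" for s
    by (rule has_field_derivative_transform_within_open[OF L'[OF that], of "{-\<delta><..<\<delta>}"])
      (use that LQ \<delta>\<epsilon> in auto)
  from local_min_second_derivative[OF \<delta>(1) this l min]
  show "(L has_real_derivative 0) (at 0)" "(deriv ^^ 2) L 0 \<ge> 0" by simp_all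
qed

lemma LOC_segment_stable:
  fixes lam \<theta> :: real and n p :: nat
  defines "t \<equiv> tan \<theta>"
  defines "a0 \<equiv> 1 + lam\<^sup>2 * t\<^sup>2"
  assumes "p \<le> n" "n \<ge> 2"
    and "real p * (lam\<^sup>2 - 1) = real (n - p) * a0"
    and "real p * (2 * (t\<^sup>2 + lam\<^sup>2) / a0 - 4 * t\<^sup>2 * (lam\<^sup>2 - 1)\<^sup>2 / a0\<^sup>2)
      - 2 * real (n - p) * t\<^sup>2 > - 2 * ((real n - 1) / 2)\<^sup>2"
  shows "stable_geodesic_segment quotient_space (quotient_metric n p lam) {0<..1} (LOC_curve \<theta>)"
proof -
  have d: "(LOC_curve \<theta> has_vector_derivative (1, t)) (at \<tau> within {0<..1})" for \<tau>
    using bounded_linear_imp_has_derivative[OF bounded_linear_LOC_curve, of \<theta>]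
    by (simp add: has_vector_derivative_def LOC_curve_def[abs_def] t_def mult.commute)
  have "vector_derivative (LOC_curve \<theta>) (at \<tau> within {0<..1}) \<noteq> 0" if "\<tau> \<in> {0<..1}" for \<tau>
  proof -
    \<comment> \<open>At \<tau> = 1 the derivative is one-sided; a nontrivial filter is what makes
      the vector derivative unique.\<close>
    have "at \<tau> within {0<..1} \<noteq> bot"
      using that by (simp add: trivial_limit_within islimpt_Ioc)
    from vector_derivative_within[OF this d] show ?thesis by (simp add: zero_prod_def)
  qed
  moreover have "smooth_map_on {0<..1} (LOC_curve \<theta>)"
    unfolding smooth_map_on_def
    using smooth_on_bounded_linear[OF bounded_linear_LOC_curve] open_UNIV by blast
  moreover have "LOC_curve \<theta> ` {0<..1} \<subseteq> quotient_space"
    by (auto simp: LOC_curve_def quotient_space_def)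
  ultimately show ?thesis
    unfolding stable_geodesic_segment_def geodesic_segment_def
    using LOC_variation_comparison[OF assms(3,4,5,6)[unfolded a0_def t_def]] by blast
qed

section \<open>Orthonormal bases and singular values\<close>

text \<open>The sum is the orthogonal projection of z onto \<open>span B\<close>: its difference
  from z is orthogonal to each basis vector.\<close>

lemma orthonormal_expansion:
  fixes B :: "'a::euclidean_space set"
  assumes "pairwise orthogonal B" "\<And>e. e \<in> B \<Longrightarrow> norm e = 1" "u \<in> span B"
  shows "(\<Sum>e\<in>B. (e \<bullet> z) *\<^sub>R e) \<bullet> u = z \<bullet> u"
proof -
  have fin: "finite B" using assms(1) by (rule pairwise_orthogonal_imp_finite)
  have "orthogonal ((\<Sum>e\<in>B. (e \<bullet> z) *\<^sub>R e) - z) u"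
  proof (rule orthogonal_to_span[OF assms(3)])
    fix v assume v: "v \<in> B"
    have "(\<Sum>e\<in>B. (e \<bullet> z) *\<^sub>R e) \<bullet> v = (\<Sum>e\<in>B. if e = v then v \<bullet> z else 0)"
      unfolding inner_sum_left
    proof (rule sum.cong[OF refl])
      fix e assume "e \<in> B"
      then show "(e \<bullet> z) *\<^sub>R e \<bullet> v = (if e = v then v \<bullet> z else 0)"
        using v assms(1,2) by (auto simp: pairwise_def orthogonal_def dot_square_norm)
    qed
    also have "\<dots> = v \<bullet> z" using fin v by simp
    finally show "orthogonal ((\<Sum>e\<in>B. (e \<bullet> z) *\<^sub>R e) - z) v"
      by (simp add: orthogonal_def inner_diff_left inner_commute[of z])
  qed
  then show ?thesis by (simp add: orthogonal_def inner_diff_left)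
qed

text \<open>Each side is the inner product of z with its orthogonal projection, and the projection
  depends on the span only.\<close>

lemma orthonormal_sum_inner_square:
  fixes B B' :: "'a::euclidean_space set"
  assumes "pairwise orthogonal B" "\<And>e. e \<in> B \<Longrightarrow> norm e = 1"
    and "pairwise orthogonal B'" "\<And>e. e \<in> B' \<Longrightarrow> norm e = 1"
    and "span B = span B'"
  shows "(\<Sum>e\<in>B. (e \<bullet> z)\<^sup>2) = (\<Sum>e\<in>B'. (e \<bullet> z)\<^sup>2)"
proof -
  define y where "y = (\<Sum>e\<in>B. (e \<bullet> z) *\<^sub>R e)"
  define y' where "y' = (\<Sum>e\<in>B'. (e \<bullet> z) *\<^sub>R e)"
  have "y \<in> span B" "y' \<in> span B'"
    unfolding y_def y'_def by (intro span_sum span_scale span_base; assumption)+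
  then have "y - y' \<in> span B" using assms(5) span_diff by blast
  then have "(y - y') \<bullet> (y - y') = 0"
    using orthonormal_expansion[OF assms(1,2), of "y - y'" z]
      orthonormal_expansion[OF assms(3,4), of "y - y'" z] assms(5)
    by (simp add: y_def y'_def inner_diff_left)
  then have "y = y'" by simp
  moreover have "y \<bullet> z = (\<Sum>e\<in>B. (e \<bullet> z)\<^sup>2)" "y' \<bullet> z = (\<Sum>e\<in>B'. (e \<bullet> z)\<^sup>2)"
    unfolding y_def y'_def by (simp_all add: inner_sum_left power2_eq_square)
  ultimately show ?thesis by simp
qed

text \<open>The trace of A^*A on a subspace. It permits replacing the basis supplied by minimality,
  or the standard basis, by one adapted to the singular values. The adjoint reduces it to the scalar
  case, one coordinate of the target at a time.\<close>

lemma orthonormal_trace: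
  fixes A :: "'a::euclidean_space \<Rightarrow> 'b::euclidean_space"
  assumes "linear A"
    and "pairwise orthogonal B" "\<And>e. e \<in> B \<Longrightarrow> norm e = 1"
    and "pairwise orthogonal B'" "\<And>e. e \<in> B' \<Longrightarrow> norm e = 1"
    and "span B = span B'"
  shows "(\<Sum>e\<in>B. A e \<bullet> A e) = (\<Sum>e\<in>B'. A e \<bullet> A e)"
proof -
  have *: "(\<Sum>e\<in>C. A e \<bullet> A e) = (\<Sum>b\<in>Basis. \<Sum>e\<in>C. (e \<bullet> adjoint A b)\<^sup>2)" for C
  proof -
    have "A e \<bullet> A e = (\<Sum>b\<in>Basis. (e \<bullet> adjoint A b)\<^sup>2)" for e
      using euclidean_inner[of "A e" "A e"] by (simp only: adjoint_works[OF assms(1)] power2_eq_square)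
    then show ?thesis by (simp add: sum.swap[of _ C])
  qed
  show ?thesis unfolding * using orthonormal_sum_inner_square[OF assms(2-6)] by simp
qed

section \<open>Spectral decomposition of the differential\<close>

lemma quadratic_nonneg_imp_linear_zero:
  fixes \<beta> c :: real
  assumes "\<And>s. 0 \<le> 2 * s * \<beta> + s\<^sup>2 * c"
  shows "\<beta> = 0"
proof -
  have "((\<lambda>s. 2 * s * \<beta> + s\<^sup>2 * c) has_real_derivative 2 * \<beta>) (at 0)"
    by (auto intro!: derivative_eq_intros)
  from DERIV_local_min[OF this zero_less_one] assms show ?thesis by simp
qed

text \<open>The spectral theorem for A^*A on T, proved variationally. If the two eigenspaces did not
  span T, a unit vector maximising |A v|^2 on their orthogonal complement in T would be a further
  eigenvector, although every eigenvector belongs to one of the two.\<close>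

lemma singular_decomposition:
  fixes A :: "'a::euclidean_space \<Rightarrow> 'b::euclidean_space"
  defines "E \<equiv> \<lambda>T \<sigma>. {v\<in>T. \<forall>w\<in>T. A v \<bullet> A w = \<sigma>\<^sup>2 * (v \<bullet> w)}"
  assumes A: "linear A" and T: "subspace T" and lam: "lam > 0"
    and vals: "\<forall>\<sigma>\<ge>0. \<forall>v\<in>E T \<sigma>. v \<noteq> 0 \<longrightarrow> \<sigma> = 0 \<or> \<sigma> = lam"
  obtains B0 B1 where "pairwise orthogonal (B0 \<union> B1)" "\<forall>e\<in>B0 \<union> B1. norm e = 1"
    "B0 \<inter> B1 = {}" "span (B0 \<union> B1) = T" "B0 \<subseteq> E T 0" "B1 \<subseteq> E T lam"
    "card B0 = dim (E T 0)" "card B1 = dim (E T lam)"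
proof -
  have E: "subspace (E T \<sigma>)" for \<sigma>
    using T unfolding E_def subspace_def
    by (auto simp: linear_0[OF A] linear_add[OF A] linear_cmul[OF A] inner_add_left distrib_left)
  obtain B0 where B0: "B0 \<subseteq> E T 0" "pairwise orthogonal B0" "\<And>e. e \<in> B0 \<Longrightarrow> norm e = 1"
    "card B0 = dim (E T 0)" "span B0 = E T 0" using orthonormal_basis_subspace[OF E] by metis
  obtain B1 where B1: "B1 \<subseteq> E T lam" "pairwise orthogonal B1" "\<And>e. e \<in> B1 \<Longrightarrow> norm e = 1"
    "card B1 = dim (E T lam)" "span B1 = E T lam" using orthonormal_basis_subspace[OF E] by metis
  have ort: "v \<bullet> w = 0" if "v \<in> E T 0" "w \<in> E T lam" for v w
  proof -
    have "A v \<bullet> A w = 0" using that by (auto simp: E_def)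
    moreover have "A w \<bullet> A v = lam\<^sup>2 * (w \<bullet> v)" using that by (auto simp: E_def)
    ultimately show ?thesis using lam by (simp add: inner_commute)
  qed
  have ortB: "orthogonal v w" "orthogonal w v" if "v \<in> B0" "w \<in> B1" for v w
    using ort that B0(1) B1(1) by (auto simp: orthogonal_def inner_commute)
  have disj: "B0 \<inter> B1 = {}"
  proof (rule ccontr)
    assume "B0 \<inter> B1 \<noteq> {}"
    then obtain v where "v \<in> B0" "v \<in> B1" by blast
    from ortB(1)[OF this] B0(3)[OF this(1)] show False by (simp add: orthogonal_self)
  qed
  have pw: "pairwise orthogonal (B0 \<union> B1)"
    using B0(2) B1(2) ortB unfolding pairwise_def by blast
  have ET: "E T \<sigma> \<subseteq> T" for \<sigma> by (auto simp: E_def)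
  have sub: "span (B0 \<union> B1) \<subseteq> T" using B0(1) B1(1) ET T by (intro span_minimal) auto
  have "span (B0 \<union> B1) = T"
  proof (rule ccontr)
    assume "span (B0 \<union> B1) \<noteq> T"
    then have "span (B0 \<union> B1) \<subset> span T" using sub T by (simp add: psubset_eq span_eq_iff[THEN iffD2])
    then obtain x where x: "x \<noteq> 0" "x \<in> T" "\<And>y. y \<in> span (B0 \<union> B1) \<Longrightarrow> orthogonal x y"
      using orthogonal_to_subspace_exists_gen[of "B0 \<union> B1" T] T by (metis span_eq_iff)
    define P where "P = {v\<in>T. \<forall>u\<in>span (B0 \<union> B1). v \<bullet> u = 0}"
    have P: "subspace P" using T unfolding P_def subspace_def by (auto simp: inner_add_left)
    define q where "q = (\<lambda>v. A v \<bullet> A v)"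
    have "compact (P \<inter> sphere 0 1)" using closed_subspace[OF P] by (simp add: closed_Int_compact)
    moreover have "x /\<^sub>R norm x \<in> P \<inter> sphere 0 1"
      using x T subspace_scale[OF T] by (auto simp: P_def orthogonal_def)
    moreover have "continuous_on (P \<inter> sphere 0 1) q" unfolding q_def
      using A by (intro continuous_on_inner linear_continuous_on) (auto simp: linear_conv_bounded_linear)
    ultimately obtain v where v: "v \<in> P" "norm v = 1" and mx: "\<And>w. w \<in> P \<Longrightarrow> norm w = 1 \<Longrightarrow> q w \<le> q v"
      using continuous_attains_sup[of "P \<inter> sphere 0 1" q] by (metis IntD1 IntD2 IntI empty_iff mem_sphere_0)
    have mx2: "q w \<le> q v * (w \<bullet> w)" if "w \<in> P" for w
    proof (cases "w = 0")
      case True then show ?thesis by (simp add: q_def linear_0[OF A])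
    next
      case False
      have "q (w /\<^sub>R norm w) \<le> q v"
        using False that subspace_scale[OF P] by (intro mx) auto
      moreover have "q (w /\<^sub>R norm w) = q w / (w \<bullet> w)"
        by (simp add: q_def linear_cmul[OF A] dot_square_norm power2_eq_square divide_inverse)
      ultimately have "q w / (w \<bullet> w) \<le> q v" by simp
      then show ?thesis using False by (simp add: pos_divide_le_eq)
    qed
    have vv: "v \<bullet> v = 1" using v(2) by (simp add: norm_eq_1)
    \<comment> \<open>Maximality against \<open>v + s *\<^sub>R w\<close> gives a quadratic in s
      that is nonnegative and vanishes at s = 0; its linear coefficient must be zero.\<close>
    have crit: "A v \<bullet> A w = q v * (v \<bullet> w)" if w: "w \<in> P" for w
    proof -
      have "0 \<le> 2 * s * (q v * (v \<bullet> w) - A v \<bullet> A w) + s\<^sup>2 * (q v * (w \<bullet> w) - q w)" for s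
      proof -
        have "v + s *\<^sub>R w \<in> P" using P v w by (simp add: subspace_add subspace_scale)
        from mx2[OF this] have "0 \<le> q v * ((v + s *\<^sub>R w) \<bullet> (v + s *\<^sub>R w)) - q (v + s *\<^sub>R w)" by simp
        also have "\<dots> = 2 * s * (q v * (v \<bullet> w) - A v \<bullet> A w) + s\<^sup>2 * (q v * (w \<bullet> w) - q w)"
          using vv unfolding q_def
          by (simp add: linear_add[OF A] linear_cmul[OF A] inner_add_left inner_add_right
              algebra_simps power2_eq_square inner_commute[of w v] inner_commute[of "A w" "A v"])
        finally show ?thesis .
      qed
      from quadratic_nonneg_imp_linear_zero[OF this] show ?thesis by simp
    qed
    have q0: "q v \<ge> 0" by (simp add: q_def)
    \<comment> \<open>Criticality of v was tested inside \<open>P\<close> only. Being an eigenvector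
      on all of \<open>T\<close> also requires A v to be orthogonal to the image of the two
      eigenspaces.\<close>
    have Au: "A v \<bullet> A u = 0" if "u \<in> span (B0 \<union> B1)" for u
    proof -
      have "orthogonal (adjoint A (A v)) u"
      proof (rule orthogonal_to_span[OF that])
        fix y assume y: "y \<in> B0 \<union> B1"
        then obtain \<sigma> where "y \<in> E T \<sigma>" using B0(1) B1(1) by blast
        then have "A y \<bullet> A v = \<sigma>\<^sup>2 * (y \<bullet> v)" using v by (auto simp: E_def P_def)
        moreover have "y \<bullet> v = 0" using v span_base[OF y] by (simp add: P_def inner_commute[of y])
        ultimately show "orthogonal (adjoint A (A v)) y"
          by (simp add: orthogonal_def adjoint_works[OF A] inner_commute)
      qed
      then show ?thesis by (simp add: orthogonal_def adjoint_works[OF A] inner_commute)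
    qed
    have "v \<in> E T (sqrt (q v))"
      unfolding E_def
    proof (intro CollectI conjI ballI)
      show "v \<in> T" using v by (simp add: P_def)
      fix w assume w: "w \<in> T"
      obtain y z where yz: "w = y + z" "y \<in> span (B0 \<union> B1)" "\<And>u. u \<in> span (B0 \<union> B1) \<Longrightarrow> orthogonal z u"
        using orthogonal_subspace_decomp_exists[of "B0 \<union> B1" w] by metis
      have "z \<in> T" using yz(1,2) w sub T by (metis add_diff_cancel_left' subspace_diff subsetD)
      then have z: "z \<in> P" using yz(3) by (auto simp: P_def orthogonal_def)
      have "v \<bullet> y = 0" using v yz(2) by (simp add: P_def)
      then show "A v \<bullet> A w = (sqrt (q v))\<^sup>2 * (v \<bullet> w)"
        using crit[OF z] Au[OF yz(2)] q0 by (simp add: yz(1) linear_add[OF A] inner_add_right)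
    qed
    moreover have "v \<noteq> 0" using v by auto
    ultimately have "v \<in> E T 0 \<or> v \<in> E T lam" using vals q0 by (metis real_sqrt_ge_zero)
    then have "v \<in> span (B0 \<union> B1)" using B0(5) B1(5) span_mono[of B0 "B0 \<union> B1"] span_mono[of B1 "B0 \<union> B1"] by blast
    then have "v \<bullet> v = 0" using v by (simp add: P_def)
    with \<open>v \<noteq> 0\<close> show False by simp
  qed
  with that[OF pw _ disj _ B0(1) B1(1) B0(4) B1(4)] B0(3) B1(3) show ?thesis by blast
qed

section \<open>Minimality of Lawson--Osserman submanifolds\<close>

lemma great_circle:
  fixes x v :: "'a::euclidean_space"
  assumes "norm x = 1" "x \<bullet> v = 0"
  obtains c where "smooth_on UNIV c" "range c \<subseteq> sphere 0 1" "c 0 = x"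
    "(c has_vector_derivative v) (at (0::real))"
proof -
  \<comment> \<open>The great circle run at speed \<open>norm v\<close>. For v = 0 the frequency is
    zero and the curve is constant.\<close>
  define c where "c = (\<lambda>t::real. cos (norm v * t) *\<^sub>R x + sin (norm v * t) *\<^sub>R (v /\<^sub>R norm v))"
  have "smooth_on UNIV (\<lambda>t::real. cos t)" "smooth_on UNIV (\<lambda>t::real. sin t)"
    using Ck_on_sin_cos by (auto simp: smooth_on_def)
  moreover have lin: "smooth_on UNIV (\<lambda>t. norm v * t)"
    by (intro smooth_on_bounded_linear bounded_linear_mult_right)
  ultimately have "smooth_on UNIV (\<lambda>t::real. cos (norm v * t))" "smooth_on UNIV (\<lambda>t::real. sin (norm v * t))"
    using smooth_on_compose[OF _ lin, of UNIV] by auto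
  then have "smooth_on UNIV c"
    unfolding c_def by (intro smooth_on_add smooth_on_scaleR smooth_on_const)
  moreover have "range c \<subseteq> sphere 0 1"
  proof clarify
    fix t
    have "c t \<bullet> c t = 1"
    proof (cases "v = 0")
      case True
      then show ?thesis using assms(1) by (simp add: c_def dot_square_norm)
    next
      case False
      have "c t \<bullet> c t = (cos (norm v * t))\<^sup>2 * (x \<bullet> x) + (sin (norm v * t))\<^sup>2 * ((v /\<^sub>R norm v) \<bullet> (v /\<^sub>R norm v))"
        using assms(2) by (simp add: c_def inner_add_left inner_add_right inner_commute power2_eq_square)
      also have "(v /\<^sub>R norm v) \<bullet> (v /\<^sub>R norm v) = 1"
        using False by (simp add: dot_square_norm power2_eq_square)
      finally show ?thesis using assms(1) by (simp add: dot_square_norm)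
    qed
    then show "c t \<in> sphere 0 1" by (simp add: norm_eq_1)
  qed
  moreover have "c 0 = x" by (simp add: c_def)
  moreover have "(c has_vector_derivative v) (at 0)"
    unfolding c_def
    by (rule has_vector_derivative_eq_rhs[OF has_vector_derivative_add[OF
          has_vector_derivative_scaleR[of _ 0, OF _ has_vector_derivative_const]
          has_vector_derivative_scaleR[of _ "norm v", OF _ has_vector_derivative_const]]])
      (auto intro!: derivative_eq_intros, cases "v = 0", auto)
  ultimately show ?thesis using that by blast
qed

lemma constant_norm_derivative:
  fixes c :: "real \<Rightarrow> 'a::real_inner"
  assumes "(c has_vector_derivative v) (at 0)" "\<epsilon> > 0" "\<And>t. t \<in> {-\<epsilon><..<\<epsilon>} \<Longrightarrow> c t \<bullet> c t = r"
  shows "c 0 \<bullet> v = 0"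
proof -
  have "((\<lambda>t. c t \<bullet> c t) has_vector_derivative (c 0 \<bullet> v + v \<bullet> c 0)) (at 0)"
    by (rule bounded_bilinear.has_vector_derivative[OF bounded_bilinear_inner assms(1,1)])
  moreover have "((\<lambda>t. c t \<bullet> c t) has_vector_derivative 0) (at 0)"
    by (rule has_vector_derivative_transform_within_open[of "\<lambda>_. r" _ _ "{-\<epsilon><..<\<epsilon>}"])
      (use assms in auto)
  ultimately show ?thesis
    using vector_derivative_unique_at by (fastforce simp: inner_commute)
qed

lemma tangent_space_sphere:
  fixes x :: "'a::euclidean_space"
  assumes "x \<in> sphere 0 1"
  shows "tangent_space (sphere 0 1) x = {v. x \<bullet> v = 0}"
proof
  show "tangent_space (sphere 0 1) x \<subseteq> {v. x \<bullet> v = 0}"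
  proof
    fix v assume "v \<in> tangent_space (sphere 0 1) x"
    then obtain c and \<epsilon> :: real where c: "\<epsilon> > 0" "c ` {-\<epsilon><..<\<epsilon>} \<subseteq> sphere 0 1" "c 0 = x"
      "(c has_vector_derivative v) (at 0)" unfolding tangent_space_def by blast
    then have "c t \<bullet> c t = 1" if "t \<in> {-\<epsilon><..<\<epsilon>}" for t
      using that by (auto simp: image_subset_iff norm_eq_1)
    from constant_norm_derivative[OF c(4,1) this] c(3) show "v \<in> {v. x \<bullet> v = 0}" by simp
  qed
  show "{v. x \<bullet> v = 0} \<subseteq> tangent_space (sphere 0 1) x"
  proof
    fix v assume "v \<in> {v. x \<bullet> v = 0}"
    then obtain c where c: "smooth_on UNIV c" "range c \<subseteq> sphere 0 1" "c 0 = x"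
      "(c has_vector_derivative v) (at (0::real))" using great_circle[of x v] assms by auto
    then show "v \<in> tangent_space (sphere 0 1) x"
      unfolding tangent_space_def using smooth_on_subset[OF c(1)]
      by (intro CollectI exI[of _ c] exI[of _ 1]) auto
  qed
qed

lemma smooth_map_on_sphere_differential:
  fixes f :: "'a::euclidean_space \<Rightarrow> 'b::euclidean_space"
  assumes "smooth_map_on (sphere 0 1) f" "x \<in> sphere 0 1"
  shows "(f has_derivative sphere_differential f x) (at x within sphere 0 1)"
proof -
  obtain U F where U: "open U" "x \<in> U" "smooth_on U F" "\<forall>y\<in>U \<inter> sphere 0 1. F y = f y"
    using assms unfolding smooth_map_on_def by blast
  obtain d where d: "d > 0" "ball x d \<subseteq> U" using U open_contains_ball by blast
  have "(f has_derivative frechet_derivative F (at x)) (at x within sphere 0 1)"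
    by (rule has_derivative_transform_within[OF has_derivative_at_withinI[OF
          smooth_on_has_derivative[OF U(3,2)]] d(1) assms(2)])
      (use U d in \<open>auto simp: dist_commute subset_iff\<close>)
  then show ?thesis using frechet_derivative_works differentiableI by blast
qed

lemma sphere_curve_derivative:
  fixes f :: "'a::euclidean_space \<Rightarrow> 'b::euclidean_space" and c :: "real \<Rightarrow> 'a"
  assumes "(f has_derivative A) (at x within sphere 0 1)" "\<epsilon> > 0"
    "c ` {-\<epsilon><..<\<epsilon>} \<subseteq> sphere 0 1" "c 0 = x" "(c has_vector_derivative v) (at 0)"
  shows "((\<lambda>t. f (c t)) has_vector_derivative A v) (at 0)"
proof -
  have w: "at (0::real) within {-\<epsilon><..<\<epsilon>} = at 0"
    using assms(2) by (intro at_within_open) auto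
  have "((f \<circ> c) has_vector_derivative A v) (at 0 within {-\<epsilon><..<\<epsilon>})"
    using assms has_derivative_subset[OF assms(1) assms(3)]
    by (intro vector_derivative_diff_chain_within) (auto simp: w)
  then show ?thesis by (simp add: w o_def)
qed

lemma tangent_space_LOM:
  fixes f :: "'a::euclidean_space \<Rightarrow> 'b::euclidean_space"
  assumes sm: "smooth_map_on (sphere 0 1) f" and x: "x \<in> sphere 0 1"
    and \<theta>: "cos \<theta> \<noteq> 0"
  shows "tangent_space (LOM_submanifold f \<theta>) (cos \<theta> *\<^sub>R x, sin \<theta> *\<^sub>R f x) =
    (\<lambda>v. (cos \<theta> *\<^sub>R v, sin \<theta> *\<^sub>R sphere_differential f x v)) ` {v. x \<bullet> v = 0}"
    (is "?T = ?J ` _")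
proof
  note A = smooth_map_on_sphere_differential[OF sm x]
  show "?T \<subseteq> ?J ` {v. x \<bullet> v = 0}"
  proof
    fix e assume "e \<in> ?T"
    then obtain c and \<epsilon> :: real where c: "\<epsilon> > 0" "c ` {-\<epsilon><..<\<epsilon>} \<subseteq> LOM_submanifold f \<theta>"
      "c 0 = (cos \<theta> *\<^sub>R x, sin \<theta> *\<^sub>R f x)" "(c has_vector_derivative e) (at 0)"
      unfolding tangent_space_def by blast
    \<comment> \<open>As \<open>cos \<theta>\<close> is nonzero, the first component of a point of
      the submanifold determines its parameter on the sphere.\<close>
    define \<gamma> where "\<gamma> = (\<lambda>t. fst (c t) /\<^sub>R cos \<theta>)"
    define v where "v = fst e /\<^sub>R cos \<theta>"
    have \<gamma>: "\<gamma> t \<in> sphere 0 1 \<and> snd (c t) = sin \<theta> *\<^sub>R f (\<gamma> t)" if "t \<in> {-\<epsilon><..<\<epsilon>}" for t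
    proof -
      have "c t \<in> LOM_submanifold f \<theta>" using c(2) that by blast
      then obtain z where "z \<in> sphere 0 1" "c t = (cos \<theta> *\<^sub>R z, sin \<theta> *\<^sub>R f z)"
        unfolding LOM_submanifold_def by blast
      then show ?thesis using \<theta> by (simp add: \<gamma>_def)
    qed
    then have \<gamma>S: "\<gamma> ` {-\<epsilon><..<\<epsilon>} \<subseteq> sphere 0 1" by blast
    have \<gamma>0: "\<gamma> 0 = x" using c(3) \<theta> by (simp add: \<gamma>_def)
    have d\<gamma>: "(\<gamma> has_vector_derivative v) (at 0)" unfolding \<gamma>_def v_def
      by (intro bounded_linear.has_vector_derivative[OF bounded_linear_scaleR_right]
          bounded_linear.has_vector_derivative[OF bounded_linear_fst c(4)])
    have "x \<bullet> v = 0"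
      using constant_norm_derivative[OF d\<gamma> c(1), of 1] \<gamma> \<gamma>0 by (simp add: norm_eq_1)
    moreover have "snd e = sin \<theta> *\<^sub>R sphere_differential f x v"
    proof (rule vector_derivative_unique_at)
      show "((\<lambda>t. snd (c t)) has_vector_derivative snd e) (at 0)"
        by (rule bounded_linear.has_vector_derivative[OF bounded_linear_snd c(4)])
      have "((\<lambda>t. sin \<theta> *\<^sub>R f (\<gamma> t)) has_vector_derivative sin \<theta> *\<^sub>R sphere_differential f x v) (at 0)"
        by (rule bounded_linear.has_vector_derivative[OF bounded_linear_scaleR_right
              sphere_curve_derivative[OF A c(1) \<gamma>S \<gamma>0 d\<gamma>]])
      then show "((\<lambda>t. snd (c t)) has_vector_derivative sin \<theta> *\<^sub>R sphere_differential f x v) (at 0)"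
        by (rule has_vector_derivative_transform_within_open[of _ _ _ "{-\<epsilon><..<\<epsilon>}"])
          (use c(1) \<gamma> in auto)
    qed
    ultimately have "e = ?J v" "x \<bullet> v = 0" using \<theta> by (simp_all add: v_def prod_eq_iff)
    then show "e \<in> ?J ` {v. x \<bullet> v = 0}" by blast
  qed
  show "?J ` {v. x \<bullet> v = 0} \<subseteq> ?T"
  proof clarify
    fix v assume "x \<bullet> v = 0"
    then obtain c where c: "smooth_on UNIV c" "range c \<subseteq> sphere 0 1" "c 0 = x"
      "(c has_vector_derivative v) (at (0::real))" using great_circle[of x v] x by auto
    \<comment> \<open>\<open>f\<close> is smooth only as a local restriction of some
      \<open>F\<close>, while tangent vectors are defined by smooth curves; so the great circle is
      cut down to times at which it stays in \<open>U\<close>.\<close>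
    obtain U F where U: "open U" "x \<in> U" "smooth_on U F" "\<forall>y\<in>U \<inter> sphere 0 1. F y = f y"
      using sm x unfolding smooth_map_on_def by blast
    have "open (c -` U)" using smooth_on_continuous[OF c(1)] U(1) by (simp add: open_vimage)
    moreover have "0 \<in> c -` U" using U c by simp
    ultimately obtain \<epsilon> where \<epsilon>: "\<epsilon> > 0" "ball 0 \<epsilon> \<subseteq> c -` U" using open_contains_ball by metis
    define I where "I = {-\<epsilon><..<\<epsilon>}"
    have I: "open I" "0 \<in> I" "c ` I \<subseteq> U"
      using \<epsilon> by (auto simp: I_def subset_iff dist_real_def)
    define C where "C = (\<lambda>t. (cos \<theta> *\<^sub>R c t, sin \<theta> *\<^sub>R f (c t)))"
    have cI: "smooth_on I c" using smooth_on_subset[OF c(1)] by simp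
    have pr: "bounded_linear (\<lambda>u::'a. (cos \<theta> *\<^sub>R u, 0::'b))" "bounded_linear (\<lambda>u::'b. (0::'a, sin \<theta> *\<^sub>R u))"
      by (intro bounded_linear_Pair bounded_linear_scaleR_right bounded_linear_zero)+
    have "smooth_on I (\<lambda>t. (cos \<theta> *\<^sub>R c t, 0) + (0, sin \<theta> *\<^sub>R F (c t)))"
      by (intro smooth_on_add smooth_on_compose_bounded_linear[OF pr(1) cI]
          smooth_on_compose_bounded_linear[OF pr(2) smooth_on_compose[OF U(3) cI I(3)]])
    then have smC: "smooth_on I C"
      by (rule smooth_on_cong[OF I(1)]) (use U(4) c(2) I(3) in \<open>auto simp: C_def\<close>)
    have "((\<lambda>t. f (c t)) has_vector_derivative sphere_differential f x v) (at 0)"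
      by (rule sphere_curve_derivative[OF A zero_less_one _ c(3,4)]) (use c(2) in auto)
    then have "(C has_vector_derivative ?J v) (at 0)" unfolding C_def
      by (intro has_vector_derivative_Pair bounded_linear.has_vector_derivative[OF bounded_linear_scaleR_right] c(4))
    moreover have "C ` I \<subseteq> LOM_submanifold f \<theta>" using c(2) by (auto simp: C_def LOM_submanifold_def)
    moreover have "C 0 = (cos \<theta> *\<^sub>R x, sin \<theta> *\<^sub>R f x)" by (simp add: C_def c(3))
    ultimately show "?J v \<in> ?T"
      using smC \<epsilon>(1) unfolding tangent_space_def I_def by blast
  qed
qed

text \<open>The submanifold lies in the product of the spheres of radii cos \<theta> and |sin
  \<theta>|, so both components of its curves have constant norm.\<close>

lemma tangent_LOM_orthogonal:
  fixes f :: "'a::euclidean_space \<Rightarrow> 'b::euclidean_space"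
  assumes "f ` sphere 0 1 \<subseteq> sphere 0 1" "e \<in> tangent_space (LOM_submanifold f \<theta>) y"
  shows "fst y \<bullet> fst e = 0" "snd y \<bullet> snd e = 0"
proof -
  obtain c and \<epsilon> :: real where c: "\<epsilon> > 0" "c ` {-\<epsilon><..<\<epsilon>} \<subseteq> LOM_submanifold f \<theta>" "c 0 = y"
    "(c has_vector_derivative e) (at 0)"
    using assms(2) unfolding tangent_space_def by blast
  have *: "fst (c t) \<bullet> fst (c t) = (cos \<theta>)\<^sup>2" "snd (c t) \<bullet> snd (c t) = (sin \<theta>)\<^sup>2"
    if "t \<in> {-\<epsilon><..<\<epsilon>}" for t
  proof -
    have "c t \<in> LOM_submanifold f \<theta>" using c(2) that by blast
    then obtain z where "z \<in> sphere 0 1" "c t = (cos \<theta> *\<^sub>R z, sin \<theta> *\<^sub>R f z)"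
      unfolding LOM_submanifold_def by blast
    moreover from this have "f z \<in> sphere 0 1" using assms(1) by blast
    ultimately show "fst (c t) \<bullet> fst (c t) = (cos \<theta>)\<^sup>2" "snd (c t) \<bullet> snd (c t) = (sin \<theta>)\<^sup>2"
      by (simp_all add: norm_eq_1 power2_eq_square)
  qed
  show "fst y \<bullet> fst e = 0"
    using constant_norm_derivative[OF bounded_linear.has_vector_derivative[OF bounded_linear_fst c(4)] c(1) *(1)]
      c(3) by simp
  show "snd y \<bullet> snd e = 0"
    using constant_norm_derivative[OF bounded_linear.has_vector_derivative[OF bounded_linear_snd c(4)] c(1) *(2)]
      c(3) by simp
qed

text \<open>The mean curvature is tested against the normal field that the linear map
  \<open>(a, b) \<mapsto> (- sin\<^sup>2 \<theta> a, cos\<^sup>2 \<theta> b)\<close> induces on the submanifold.\<close>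

lemma minimal_LOM_trace:
  fixes f :: "'a::euclidean_space \<Rightarrow> 'b::euclidean_space"
  assumes f: "f ` sphere 0 1 \<subseteq> sphere 0 1" and ang: "LOM_angle f \<theta>" and x: "x \<in> sphere 0 1"
  defines "y \<equiv> (cos \<theta> *\<^sub>R x, sin \<theta> *\<^sub>R f x)"
  obtains B where "pairwise orthogonal B" "\<And>e. e \<in> B \<Longrightarrow> norm e = 1"
    "span B = tangent_space (LOM_submanifold f \<theta>) y"
    "(sin \<theta>)\<^sup>2 * (\<Sum>e\<in>B. fst e \<bullet> fst e) = (cos \<theta>)\<^sup>2 * (\<Sum>e\<in>B. snd e \<bullet> snd e)"
proof -
  define M where "M = LOM_submanifold f \<theta>"
  define N :: "'a \<times> 'b \<Rightarrow> 'a \<times> 'b" where "N = (\<lambda>z. (- (sin \<theta>)\<^sup>2 *\<^sub>R fst z, (cos \<theta>)\<^sup>2 *\<^sub>R snd z))"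
  have Nlin: "bounded_linear N" unfolding N_def
    by (intro bounded_linear_Pair bounded_linear_compose[OF bounded_linear_scaleR_right]
        bounded_linear_fst bounded_linear_snd)
  have y: "y \<in> M" using x by (auto simp: y_def M_def LOM_submanifold_def)
  have perp: "u \<bullet> N z = 0" if "u \<in> tangent_space M z" for u z
    using tangent_LOM_orthogonal[OF f that[unfolded M_def]]
    by (simp add: N_def inner_prod_def inner_commute)
  have "f x \<in> sphere 0 1" using x f by blast
  then have "norm x = 1" "norm (f x) = 1" using x by simp_all
  \<comment> \<open>The two contributions - sin^2 cos^2 and cos^2 sin^2 cancel: the normal
    \<open>N y\<close> is tangent to the unit sphere.\<close>
  then have perpy: "y \<bullet> N y = 0"
    by (simp add: N_def y_def inner_prod_def norm_eq_1 power2_eq_square)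
  obtain B II where B: "pairwise orthogonal B" "\<forall>e\<in>B. norm e = 1" "span B = tangent_space M y"
    and II: "\<forall>e\<in>B. sphere_second_fundamental_form M y e e (II e)" "(\<Sum>e\<in>B. II e) = 0"
    using ang y unfolding LOM_angle_def minimal_submanifold_of_sphere_def M_def by blast
  \<comment> \<open>The Weingarten identity: differentiate W \<bullet> N = 0 along a curve with
    velocity e. Linearity of \<open>N\<close> makes the derivative of the normal field equal to
    \<open>N e\<close>.\<close>
  have "II e \<bullet> N y = - (e \<bullet> N e)" if eB: "e \<in> B" for e
  proof -
    obtain W D where WD: "\<forall>z\<in>M. W z \<in> tangent_space M z" "W y = e" "(W has_derivative D) (at y within M)"
      "D e - II e \<in> span (insert y (tangent_space M y))"
      using bspec[OF II(1) eB] unfolding sphere_second_fundamental_form_def by auto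
    have "orthogonal (N y) (D e - II e)"
    proof (rule orthogonal_to_span[OF WD(4)])
      fix u assume "u \<in> insert y (tangent_space M y)"
      then have "u \<bullet> N y = 0" using perp[of u y] perpy by blast
      then show "orthogonal (N y) u" by (simp add: orthogonal_def inner_commute)
    qed
    then have DII: "II e \<bullet> N y = D e \<bullet> N y"
      by (simp add: orthogonal_def inner_diff_right inner_commute)
    have "e \<in> tangent_space M y" using B(3) span_base[OF eB] by blast
    then obtain c and \<epsilon> :: real where c: "\<epsilon> > 0" "c ` {-\<epsilon><..<\<epsilon>} \<subseteq> M" "c 0 = y"
      "(c has_vector_derivative e) (at 0)"
      unfolding tangent_space_def by blast
    have w: "at (0::real) within {-\<epsilon><..<\<epsilon>} = at 0" using c(1) by (intro at_within_open) auto
    have "((W \<circ> c) has_vector_derivative D e) (at 0 within {-\<epsilon><..<\<epsilon>})"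
      using c(3,4) has_derivative_subset[OF WD(3) c(2)]
      by (intro vector_derivative_diff_chain_within) (auto simp: w)
    then have dW: "((\<lambda>t. W (c t)) has_vector_derivative D e) (at 0)" by (simp add: w o_def)
    have dN: "((\<lambda>t. N (c t)) has_vector_derivative N e) (at 0)"
      by (rule bounded_linear.has_vector_derivative[OF Nlin c(4)])
    have "((\<lambda>t. W (c t) \<bullet> N (c t)) has_vector_derivative (W (c 0) \<bullet> N e + D e \<bullet> N (c 0))) (at 0)"
      by (rule bounded_bilinear.has_vector_derivative[OF bounded_bilinear_inner dW dN])
    moreover have "((\<lambda>t. W (c t) \<bullet> N (c t)) has_vector_derivative 0) (at 0)"
    proof (rule has_vector_derivative_transform_within_open[of "\<lambda>_. 0" _ _ "{-\<epsilon><..<\<epsilon>}"])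
      fix t assume "t \<in> {-\<epsilon><..<\<epsilon>}"
      then have "c t \<in> M" using c(2) by blast
      then show "0 = W (c t) \<bullet> N (c t)" using perp WD(1) by metis
    qed (use c(1) in auto)
    ultimately have "W (c 0) \<bullet> N e + D e \<bullet> N (c 0) = 0" by (rule vector_derivative_unique_at)
    then show ?thesis using DII WD(2) c(3) by simp
  qed
  then have "(\<Sum>e\<in>B. e \<bullet> N e) = - ((\<Sum>e\<in>B. II e) \<bullet> N y)" by (simp add: inner_sum_left sum_negf)
  then have "(\<Sum>e\<in>B. e \<bullet> N e) = 0" by (simp add: II(2))
  moreover have "(\<Sum>e\<in>B. e \<bullet> N e) =
      (cos \<theta>)\<^sup>2 * (\<Sum>e\<in>B. snd e \<bullet> snd e) - (sin \<theta>)\<^sup>2 * (\<Sum>e\<in>B. fst e \<bullet> fst e)"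
    by (simp add: N_def inner_prod_def sum_distrib_left sum_subtractf[symmetric])
  ultimately show ?thesis using that B unfolding M_def by auto
qed

text \<open>The parametrization maps the singular bases to an orthogonal basis of the tangent space
  of the submanifold, with squared lengths cos^2 on \<open>B0\<close> and cos^2 + lam^2 sin^2 on
  \<open>B1\<close>. After normalisation, the trace identity for minimality becomes a count of basis
  vectors.\<close>

lemma LOM_angle_equation:
  fixes f :: "'a::euclidean_space \<Rightarrow> 'b::euclidean_space"
  assumes sm: "smooth_map_on (sphere 0 1) f" and f: "f ` sphere 0 1 \<subseteq> sphere 0 1"
    and ang: "LOM_angle f \<theta>" and x: "x \<in> sphere 0 1" and lam: "lam > 0"
    and B: "pairwise orthogonal (B0 \<union> B1)" "\<And>e. e \<in> B0 \<union> B1 \<Longrightarrow> norm e = 1" "B0 \<inter> B1 = {}"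
      "span (B0 \<union> B1) = {v. x \<bullet> v = 0}"
    and B0: "B0 \<subseteq> singular_space f x 0" and B1: "B1 \<subseteq> singular_space f x lam"
  shows "real (card B1) * (lam\<^sup>2 - 1) = real (card B0) * (1 + lam\<^sup>2 * (tan \<theta>)\<^sup>2)"
proof -
  have \<theta>: "0 < \<theta>" "\<theta> < pi / 2" using ang by (auto simp: LOM_angle_def)
  have c: "cos \<theta> > 0" using \<theta> cos_gt_zero by blast
  have s: "sin \<theta> > 0" using \<theta> by (intro sin_gt_zero) auto
  define A where "A = sphere_differential f x"
  have Alin: "linear A" unfolding A_def
    using smooth_map_on_sphere_differential[OF sm x] has_derivative_linear by blast
  define J where "J = (\<lambda>v. (cos \<theta> *\<^sub>R v, sin \<theta> *\<^sub>R A v))"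
  have Jlin: "linear J" unfolding J_def
    by (rule linearI) (simp_all add: linear_add[OF Alin] linear_cmul[OF Alin] scaleR_add_right)
  define d where "d = (cos \<theta>)\<^sup>2 + (sin \<theta>)\<^sup>2 * lam\<^sup>2"
  have d: "d > 0" using c by (simp add: d_def add_pos_nonneg)
  \<comment> \<open>The squared length of \<open>J v\<close> for v in \<open>B0\<close> or
    \<open>B1\<close>.\<close>
  define D where "D = (\<lambda>v. if v \<in> B0 then (cos \<theta>)\<^sup>2 else d)"
  have D: "D v > 0" for v using c d by (simp add: D_def)
  define e where "e = (\<lambda>v. J v /\<^sub>R sqrt (D v))"
  have fin: "finite (B0 \<union> B1)" using B(1) by (rule pairwise_orthogonal_imp_finite)
  have T: "tangent_space (sphere 0 1) x = {v. x \<bullet> v = 0}" using tangent_space_sphere[OF x] .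
  have vT: "v \<in> {v. x \<bullet> v = 0}" if "v \<in> B0 \<union> B1" for v using span_base[OF that] B(4) by simp
  have AA: "A v \<bullet> A w = (if v \<in> B0 then 0 else lam\<^sup>2 * (v \<bullet> w))" if "v \<in> B0 \<union> B1" "w \<in> B0 \<union> B1" for v w
    using that B0 B1 vT[OF that(2)] B(3) unfolding singular_space_def T A_def by (auto split: if_splits)
  have vw: "v \<bullet> w = (if v = w then 1 else 0)" if "v \<in> B0 \<union> B1" "w \<in> B0 \<union> B1" for v w
    using that B(1,2) by (auto simp: pairwise_def orthogonal_def norm_eq_1)
  have JJ: "J v \<bullet> J w = (if v = w then D v else 0)" if "v \<in> B0 \<union> B1" "w \<in> B0 \<union> B1" for v w
    using AA[OF that] vw[OF that] by (auto simp: J_def inner_prod_def D_def d_def power2_eq_square)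
  have ee: "e v \<bullet> e w = (if v = w then 1 else 0)" if "v \<in> B0 \<union> B1" "w \<in> B0 \<union> B1" for v w
    using JJ[OF that] D[of v] by (auto simp: e_def field_simps)
  have inj: "inj_on e (B0 \<union> B1)"
  proof (rule inj_onI)
    fix v w assume vw: "v \<in> B0 \<union> B1" "w \<in> B0 \<union> B1" "e v = e w"
    then have "e v \<bullet> e w = 1" using ee[OF vw(1,1)] by simp
    then show "v = w" using ee[OF vw(1,2)] by (simp split: if_splits)
  qed
  define y where "y = (cos \<theta> *\<^sub>R x, sin \<theta> *\<^sub>R f x)"
  obtain B where Bb: "pairwise orthogonal B" "\<And>e. e \<in> B \<Longrightarrow> norm e = 1"
    "span B = tangent_space (LOM_submanifold f \<theta>) y"
    and tr: "(sin \<theta>)\<^sup>2 * (\<Sum>e\<in>B. fst e \<bullet> fst e) = (cos \<theta>)\<^sup>2 * (\<Sum>e\<in>B. snd e \<bullet> snd e)"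
    by (rule minimal_LOM_trace[OF f ang x, folded y_def]) blast
  have TM: "tangent_space (LOM_submanifold f \<theta>) y = span (J ` (B0 \<union> B1))"
  proof -
    have "tangent_space (LOM_submanifold f \<theta>) y = J ` {v. x \<bullet> v = 0}"
      using tangent_space_LOM[OF sm x, of \<theta>] c by (simp add: y_def J_def A_def)
    then show ?thesis by (simp only: linear_span_image[OF Jlin] B(4))
  qed
  have "span (e ` (B0 \<union> B1)) = span (J ` (B0 \<union> B1))"
  proof
    show "span (e ` (B0 \<union> B1)) \<subseteq> span (J ` (B0 \<union> B1))"
    proof (rule span_minimal)
      show "e ` (B0 \<union> B1) \<subseteq> span (J ` (B0 \<union> B1))"
      proof (rule image_subsetI)
        fix v assume "v \<in> B0 \<union> B1"
        then show "e v \<in> span (J ` (B0 \<union> B1))" unfolding e_def by (intro span_scale span_base) auto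
      qed
    qed simp
    show "span (J ` (B0 \<union> B1)) \<subseteq> span (e ` (B0 \<union> B1))"
    proof (rule span_minimal)
      show "J ` (B0 \<union> B1) \<subseteq> span (e ` (B0 \<union> B1))"
      proof (rule image_subsetI)
        fix v assume "v \<in> B0 \<union> B1"
        then have "sqrt (D v) *\<^sub>R e v \<in> span (e ` (B0 \<union> B1))" by (intro span_scale span_base) auto
        then show "J v \<in> span (e ` (B0 \<union> B1))" using D[of v] by (simp add: e_def)
      qed
    qed simp
  qed
  then have sp: "span B = span (e ` (B0 \<union> B1))" using Bb(3) TM by simp
  have po: "pairwise orthogonal (e ` (B0 \<union> B1))"
    using ee by (auto simp: pairwise_def orthogonal_def)
  have no: "norm u = 1" if "u \<in> e ` (B0 \<union> B1)" for u
    using that ee by (auto simp: norm_eq_1)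
  have "(sin \<theta>)\<^sup>2 * (\<Sum>u\<in>B0 \<union> B1. fst (e u) \<bullet> fst (e u)) = (cos \<theta>)\<^sup>2 * (\<Sum>u\<in>B0 \<union> B1. snd (e u) \<bullet> snd (e u))"
    using tr orthonormal_trace[OF linear_fst Bb(1,2) po no sp] orthonormal_trace[OF linear_snd Bb(1,2) po no sp]
    by (simp add: sum.reindex[OF inj] o_def)
  moreover have "fst (e u) \<bullet> fst (e u) = (if u \<in> B0 then 1 else (cos \<theta>)\<^sup>2 / d)"
    "snd (e u) \<bullet> snd (e u) = (if u \<in> B0 then 0 else (sin \<theta>)\<^sup>2 * lam\<^sup>2 / d)"
    if "u \<in> B0 \<union> B1" for u
  proof -
    have r: "inverse (sqrt (D u)) * inverse (sqrt (D u)) = 1 / D u"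
      using D[of u] by (simp add: inverse_eq_divide)
    have "fst (e u) \<bullet> fst (e u) = (cos \<theta>)\<^sup>2 * (u \<bullet> u) * (inverse (sqrt (D u)) * inverse (sqrt (D u)))"
      "snd (e u) \<bullet> snd (e u) = (sin \<theta>)\<^sup>2 * (A u \<bullet> A u) * (inverse (sqrt (D u)) * inverse (sqrt (D u)))"
      by (simp_all only: e_def J_def scaleR_Pair fst_conv snd_conv inner_scaleR_left inner_scaleR_right
          power2_eq_square ac_simps)
    then show "fst (e u) \<bullet> fst (e u) = (if u \<in> B0 then 1 else (cos \<theta>)\<^sup>2 / d)"
      "snd (e u) \<bullet> snd (e u) = (if u \<in> B0 then 0 else (sin \<theta>)\<^sup>2 * lam\<^sup>2 / d)"
      unfolding r using vw[OF that that] AA[OF that that] c by (auto simp: D_def)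
  qed
  moreover have "(\<Sum>u\<in>B0 \<union> B1. if u \<in> B0 then a else b) = card B0 * a + card B1 * b" for a b :: real
  proof -
    have "(\<Sum>u\<in>B0 \<union> B1. if u \<in> B0 then a else b) =
        (\<Sum>u\<in>B0. if u \<in> B0 then a else b) + (\<Sum>u\<in>B1. if u \<in> B0 then a else b)"
      using fin B(3) by (intro sum.union_disjoint) auto
    also have "(\<Sum>u\<in>B1. if u \<in> B0 then a else b) = (\<Sum>u\<in>B1. b)"
      using B(3) by (intro sum.cong) auto
    finally show ?thesis by simp
  qed
  ultimately have "(sin \<theta>)\<^sup>2 * (card B0 + card B1 * ((cos \<theta>)\<^sup>2 / d))
      = (cos \<theta>)\<^sup>2 * (card B1 * ((sin \<theta>)\<^sup>2 * lam\<^sup>2 / d))" by simp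
  \<comment> \<open>Clear the denominator d. The factors sin^2 here and cos^2 at the end cancel
    because \<theta> is acute.\<close>
  then have "(sin \<theta>)\<^sup>2 * (card B0 * d + card B1 * (cos \<theta>)\<^sup>2)
      = (sin \<theta>)\<^sup>2 * (card B1 * (cos \<theta>)\<^sup>2 * lam\<^sup>2)" using d by (simp add: field_simps)
  then have "card B0 * d + card B1 * (cos \<theta>)\<^sup>2 = card B1 * (cos \<theta>)\<^sup>2 * lam\<^sup>2" using s by simp
  moreover have "d = (cos \<theta>)\<^sup>2 * (1 + lam\<^sup>2 * (tan \<theta>)\<^sup>2)"
    using c by (simp add: d_def tan_def power_divide field_simps)
  ultimately have "(cos \<theta>)\<^sup>2 * (card B1 * (lam\<^sup>2 - 1)) = (cos \<theta>)\<^sup>2 * (card B0 * (1 + lam\<^sup>2 * (tan \<theta>)\<^sup>2))"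
    by (simp add: algebra_simps)
  then show ?thesis using c by simp
qed

section \<open>The energy of a map by spherical harmonics\<close>

lemma DERIV_sum_squares:
  assumes "\<And>b. b \<in> I \<Longrightarrow> (\<phi> b has_real_derivative \<phi>' b) (at t)"
  shows "((\<lambda>t. \<Sum>b\<in>I. (\<phi> b t)\<^sup>2) has_real_derivative (\<Sum>b\<in>I. 2 * \<phi> b t * \<phi>' b)) (at t)"
  using assms by (auto intro!: derivative_eq_intros DERIV_sum)

text \<open>Applying the Laplacian to \<open>\<Sum> (P b)\<^sup>2 = |x|\<^bsup>2k\<^esup>\<close> along one coordinate direction \<open>e\<close>.\<close>

lemma harmonic_line_identity:
  fixes P :: "'i \<Rightarrow> 'a::euclidean_space \<Rightarrow> real"
  assumes poly: "\<And>b. b \<in> I \<Longrightarrow> real_polynomial_function (P b)"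
    and sq: "\<And>z. (\<Sum>b\<in>I. (P b z)\<^sup>2) = (z \<bullet> z) ^ k"
    and x: "x \<bullet> x = 1" and e: "e \<bullet> e = 1"
    and D: "\<And>b. b \<in> I \<Longrightarrow> ((\<lambda>t. P b (x + t *\<^sub>R e)) has_real_derivative D b) (at 0)"
  shows "(\<Sum>b\<in>I. (D b)\<^sup>2) + (\<Sum>b\<in>I. P b x * (deriv ^^ 2) (\<lambda>t. P b (x + t *\<^sub>R e)) 0)
    = 2 * real k * (real k - 1) * (x \<bullet> e)\<^sup>2 + real k"
proof -
  define \<phi> where "\<phi> = (\<lambda>b t. P b (x + t *\<^sub>R e))"
  have line: "polynomial_function (\<lambda>t::real. x + t *\<^sub>R e)" by (intro polynomial_function_add) auto
  have "real_polynomial_function (\<phi> b)" if "b \<in> I" for b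
    using real_polynomial_function_compose[OF line poly[OF that]] by (simp add: \<phi>_def o_def)
  then have "\<forall>b\<in>I. \<exists>p. real_polynomial_function p \<and> (\<forall>t. (\<phi> b has_real_derivative p t) (at t))"
    by (metis has_real_derivative_polynomial_function)
  then obtain \<phi>1 where \<phi>1: "\<And>b. b \<in> I \<Longrightarrow> real_polynomial_function (\<phi>1 b)"
    "\<And>b t. b \<in> I \<Longrightarrow> (\<phi> b has_real_derivative \<phi>1 b t) (at t)" by metis
  then have "\<forall>b\<in>I. \<exists>p. \<forall>t. (\<phi>1 b has_real_derivative p t) (at t)"
    by (metis has_real_derivative_polynomial_function)
  then obtain \<phi>2 where \<phi>2: "\<And>b t. b \<in> I \<Longrightarrow> (\<phi>1 b has_real_derivative \<phi>2 b t) (at t)" by metis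
  have d2: "(deriv ^^ 2) (\<lambda>t. P b (x + t *\<^sub>R e)) 0 = \<phi>2 b 0" if "b \<in> I" for b
  proof -
    have "deriv (\<phi> b) = \<phi>1 b" using \<phi>1(2)[OF that] by (intro ext DERIV_imp_deriv)
    then show ?thesis using DERIV_imp_deriv[OF \<phi>2[OF that]]
      by (simp add: numeral_2_eq_2 \<phi>_def)
  qed
  have D1: "D b = \<phi>1 b 0" if "b \<in> I" for b
    using D[OF that] \<phi>1(2)[OF that, of 0] DERIV_unique by (fastforce simp: \<phi>_def)
  \<comment> \<open>The squared norm of \<open>x + t *\<^sub>R e\<close>; both sides of
    \<open>sq\<close> along this line are differentiated twice.\<close>
  define N where "N = (\<lambda>t. 1 + 2 * t * (x \<bullet> e) + t\<^sup>2)"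
  have N: "(\<Sum>b\<in>I. (\<phi> b t)\<^sup>2) = N t ^ k" for t
    unfolding \<phi>_def sq N_def using x e
    by (simp add: inner_add_left inner_add_right inner_commute power2_eq_square algebra_simps)
  have dN: "(N has_real_derivative 2 * (x \<bullet> e) + 2 * t) (at t)" for t
    unfolding N_def by (auto intro!: derivative_eq_intros)
  have first: "(\<Sum>b\<in>I. 2 * \<phi> b t * \<phi>1 b t) = real k * N t ^ (k - 1) * (2 * (x \<bullet> e) + 2 * t)" for t
  proof (rule DERIV_unique)
    show "((\<lambda>t. N t ^ k) has_real_derivative (\<Sum>b\<in>I. 2 * \<phi> b t * \<phi>1 b t)) (at t)"
      using DERIV_sum_squares[of I \<phi> "\<lambda>b. \<phi>1 b t" t] \<phi>1(2) by (simp add: N)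
    show "((\<lambda>t. N t ^ k) has_real_derivative real k * N t ^ (k - 1) * (2 * (x \<bullet> e) + 2 * t)) (at t)"
      using DERIV_power[OF dN, of k t] by (simp add: mult_ac)
  qed
  have "(\<Sum>b\<in>I. 2 * \<phi> b 0 * \<phi>2 b 0 + 2 * \<phi>1 b 0 * \<phi>1 b 0)
    = real k * (real (k - 1) * (2 * (x \<bullet> e))) * (2 * (x \<bullet> e)) + real k * 2"
  proof (rule DERIV_unique)
    have "((\<lambda>t. \<Sum>b\<in>I. 2 * \<phi> b t * \<phi>1 b t) has_real_derivative
      (\<Sum>b\<in>I. 2 * \<phi> b 0 * \<phi>2 b 0 + 2 * \<phi>1 b 0 * \<phi>1 b 0)) (at 0)"
      by (rule DERIV_sum) (auto intro!: derivative_eq_intros \<phi>1(2) \<phi>2)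
    then show "((\<lambda>t. real k * N t ^ (k - 1) * (2 * (x \<bullet> e) + 2 * t)) has_real_derivative
      (\<Sum>b\<in>I. 2 * \<phi> b 0 * \<phi>2 b 0 + 2 * \<phi>1 b 0 * \<phi>1 b 0)) (at 0)" unfolding first .
    have N0: "N 0 = 1" by (simp add: N_def)
    have dk: "((\<lambda>t. N t ^ (k - 1)) has_real_derivative real (k - 1) * (2 * (x \<bullet> e))) (at 0)"
      using DERIV_power[OF dN[of 0], of "k - 1"] by (simp add: N0 mult_ac)
    have "((\<lambda>t. 2 * (x \<bullet> e) + 2 * t) has_real_derivative 2) (at 0)"
      by (auto intro!: derivative_eq_intros)
    from DERIV_mult[OF DERIV_cmult[OF dk, of "real k"] this]
    show "((\<lambda>t. real k * N t ^ (k - 1) * (2 * (x \<bullet> e) + 2 * t)) has_real_derivative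
      real k * (real (k - 1) * (2 * (x \<bullet> e))) * (2 * (x \<bullet> e)) + real k * 2) (at 0)"
      by (simp add: N0 mult_ac)
  qed
  moreover have "(\<Sum>b\<in>I. 2 * \<phi> b 0 * \<phi>2 b 0 + 2 * \<phi>1 b 0 * \<phi>1 b 0)
    = 2 * (\<Sum>b\<in>I. \<phi> b 0 * \<phi>2 b 0) + 2 * (\<Sum>b\<in>I. (\<phi>1 b 0)\<^sup>2)"
    by (simp add: sum.distrib sum_distrib_left power2_eq_square mult.assoc)
  \<comment> \<open>Truncation in k - 1 is harmless: it occurs only for k = 0, where the factor k
    vanishes.\<close>
  moreover have "real k * (real (k - 1) * (2 * (x \<bullet> e))) * (2 * (x \<bullet> e))
    = 2 * (2 * real k * (real k - 1) * (x \<bullet> e)\<^sup>2)"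
    by (cases k) (auto simp: power2_eq_square)
  ultimately have "(\<Sum>b\<in>I. (\<phi>1 b 0)\<^sup>2) + (\<Sum>b\<in>I. \<phi> b 0 * \<phi>2 b 0)
    = 2 * real k * (real k - 1) * (x \<bullet> e)\<^sup>2 + real k"
    by linarith
  moreover have "\<phi> b 0 = P b x" for b by (simp add: \<phi>_def)
  ultimately show ?thesis by (simp add: d2 D1 cong: sum.cong)
qed

text \<open>Summing the line identity over an orthonormal basis of the whole space, the Laplacians
  drop out and the full energy is 2k(k - 1) + k DIM. By Euler's relation the radial direction
  accounts for k^2 of it; the rest is the energy on the tangent space.\<close>

lemma spherical_harmonic_energy:
  fixes f :: "'a::euclidean_space \<Rightarrow> 'b::euclidean_space"
  assumes sm: "smooth_map_on (sphere 0 1) f" and f: "f ` sphere 0 1 \<subseteq> sphere 0 1"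
    and har: "\<forall>b\<in>Basis. spherical_harmonic k (\<lambda>x. f x \<bullet> b)" and k: "k > 0"
    and x: "x \<in> sphere 0 1"
    and C: "pairwise orthogonal C" "\<And>e. e \<in> C \<Longrightarrow> norm e = 1" "span C = {v. x \<bullet> v = 0}"
  shows "(\<Sum>v\<in>C. sphere_differential f x v \<bullet> sphere_differential f x v)
    = real k * (real k + real DIM('a) - 2)"
proof -
  obtain P where poly: "\<And>b. b \<in> Basis \<Longrightarrow> real_polynomial_function (P b)"
    and hom: "\<And>b c z. b \<in> Basis \<Longrightarrow> P b (c *\<^sub>R z) = c ^ k * P b z"
    and lap: "\<And>b z. b \<in> Basis \<Longrightarrow> laplacian (P b) z = 0"
    and Pf: "\<And>b z. b \<in> Basis \<Longrightarrow> z \<in> sphere 0 1 \<Longrightarrow> f z \<bullet> b = P b z"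
    using har unfolding spherical_harmonic_def by metis
  have xx: "x \<bullet> x = 1" using x by (simp add: norm_eq_1)
  have sq1: "(\<Sum>b\<in>Basis. (P b z)\<^sup>2) = 1" if "z \<in> sphere 0 1" for z
  proof -
    have "f z \<in> sphere 0 1" using f that by blast
    then have "f z \<bullet> f z = 1" by (simp add: norm_eq_1)
    then show ?thesis using Pf[OF _ that] euclidean_inner[of "f z" "f z"]
      by (simp add: power2_eq_square)
  qed
  have sq: "(\<Sum>b\<in>Basis. (P b z)\<^sup>2) = (z \<bullet> z) ^ k" for z
  proof (cases "z = 0")
    case True
    \<comment> \<open>Here \<open>k > 0\<close> enters: for k = 0 homogeneity would not force the
      value at the origin to vanish.\<close>
    have "P b 0 = 0" if "b \<in> Basis" for b using hom[OF that, of 0 0] k by (simp add: power_0_left)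
    then show ?thesis using True k by simp
  next
    case False
    define w where "w = z /\<^sub>R norm z"
    have w: "w \<in> sphere 0 1" "z = norm z *\<^sub>R w" using False by (simp_all add: w_def)
    have "(P b z)\<^sup>2 = (z \<bullet> z) ^ k * (P b w)\<^sup>2" if "b \<in> Basis" for b
    proof -
      have "P b z = norm z ^ k * P b w" using hom[OF that, of "norm z" w] w(2) by simp
      then show ?thesis
        by (simp add: power_mult_distrib power_mult[symmetric] dot_square_norm mult.commute)
    qed
    then have "(\<Sum>b\<in>Basis. (P b z)\<^sup>2) = (z \<bullet> z) ^ k * (\<Sum>b\<in>Basis. (P b w)\<^sup>2)"
      by (simp add: sum_distrib_left)
    then show ?thesis using sq1[OF w(1)] by simp
  qed
  define F where "F = (\<lambda>z. \<Sum>b\<in>Basis. P b z *\<^sub>R b)"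
  have Ff: "F z = f z" if "z \<in> sphere 0 1" for z
    unfolding F_def using Pf[OF _ that] by (simp add: euclidean_representation[of "f z"] flip: Pf[OF _ that])
  have "polynomial_function F" unfolding F_def
    using poly by (intro polynomial_function_sum polynomial_function_mult)
      (auto simp: real_polynomial_function_eq)
  then obtain D where D: "(F has_derivative D) (at x)"
    using differentiable_at_polynomial_function unfolding differentiable_def by blast
  have Dlin: "linear D" using D has_derivative_linear by blast
  have dir: "((\<lambda>t. F (x + t *\<^sub>R e)) has_vector_derivative D e) (at 0)" for e
  proof -
    have "((\<lambda>t. x + t *\<^sub>R e) has_vector_derivative e) (at 0)" by (auto intro!: derivative_eq_intros)
    from vector_derivative_diff_chain_within[OF this, of F D] D show ?thesis
      by (simp add: o_def has_derivative_at_withinI)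
  qed
  have dirb: "((\<lambda>t. P b (x + t *\<^sub>R e)) has_real_derivative D e \<bullet> b) (at 0)" if "b \<in> Basis" for e b
    using bounded_linear.has_vector_derivative[OF bounded_linear_inner_left[of b] dir[of e]] that
    by (simp add: has_real_derivative_iff_has_vector_derivative F_def inner_sum_left inner_Basis
        if_distrib cong: if_cong)
  have "(\<Sum>e\<in>Basis. D e \<bullet> D e) = (\<Sum>e\<in>Basis. 2 * real k * (real k - 1) * (x \<bullet> e)\<^sup>2 + real k)"
  proof -
    have "D e \<bullet> D e + (\<Sum>b\<in>Basis. P b x * (deriv ^^ 2) (\<lambda>t. P b (x + t *\<^sub>R e)) 0)
      = 2 * real k * (real k - 1) * (x \<bullet> e)\<^sup>2 + real k" if "e \<in> Basis" for e
      using harmonic_line_identity[of Basis P k x e "\<lambda>b. D e \<bullet> b", OF poly sq xx _ dirb] that euclidean_inner[of "D e" "D e"]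
      by (simp add: power2_eq_square)
    then have "(\<Sum>e\<in>Basis. D e \<bullet> D e + (\<Sum>b\<in>Basis. P b x * (deriv ^^ 2) (\<lambda>t. P b (x + t *\<^sub>R e)) 0))
      = (\<Sum>e\<in>Basis. 2 * real k * (real k - 1) * (x \<bullet> e)\<^sup>2 + real k)" by simp
    moreover have "(\<Sum>e\<in>Basis. \<Sum>b\<in>Basis. P b x * (deriv ^^ 2) (\<lambda>t. P b (x + t *\<^sub>R e)) 0)
      = (\<Sum>b\<in>Basis. P b x * laplacian (P b) x)"
      by (subst sum.swap) (simp add: laplacian_def sum_distrib_left)
    ultimately show ?thesis by (simp add: sum.distrib lap)
  qed
  also have "\<dots> = 2 * real k * (real k - 1) + real DIM('a) * real k"
  proof -
    have "(\<Sum>e\<in>Basis. (x \<bullet> e)\<^sup>2) = 1"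
      using xx euclidean_inner[of x x] by (simp add: power2_eq_square)
    then show ?thesis by (simp add: sum.distrib flip: sum_distrib_left)
  qed
  finally have tot: "(\<Sum>e\<in>Basis. D e \<bullet> D e) = 2 * real k * (real k - 1) + real DIM('a) * real k" .
  \<comment> \<open>Euler's relation for homogeneous maps of degree k, read off along the ray
    through x.\<close>
  have Dx: "D x = real k *\<^sub>R F x"
  proof (rule vector_derivative_unique_at[OF dir])
    have "F (x + t *\<^sub>R x) = (1 + t) ^ k *\<^sub>R F x" for t
    proof -
      have "x + t *\<^sub>R x = (1 + t) *\<^sub>R x" by (simp add: scaleR_add_left)
      then show ?thesis by (simp add: F_def hom scaleR_sum_right cong: sum.cong)
    qed
    moreover have "((\<lambda>t. (1 + t) ^ k *\<^sub>R F x) has_vector_derivative real k *\<^sub>R F x) (at 0)"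
    proof -
      have "((\<lambda>t::real. (1 + t) ^ k) has_real_derivative real k) (at 0)"
        by (auto intro!: derivative_eq_intros)
      from has_vector_derivative_scaleR[OF this has_vector_derivative_const[of "F x"]]
      show ?thesis by simp
    qed
    ultimately show "((\<lambda>t. F (x + t *\<^sub>R x)) has_vector_derivative real k *\<^sub>R F x) (at 0)" by simp
  qed
  have "f x \<in> sphere 0 1" using f x by blast
  then have DxDx: "D x \<bullet> D x = (real k)\<^sup>2"
    using Dx Ff[OF x] by (simp add: norm_eq_1 power2_eq_square)
  have perp: "x \<bullet> v = 0" if "v \<in> C" for v using that C(3) span_base by blast
  have xC: "x \<notin> C" using perp xx by force
  have po: "pairwise orthogonal (insert x C)"
    using C(1) perp by (auto simp: pairwise_insert orthogonal_def inner_commute)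
  have no: "norm e = 1" if "e \<in> insert x C" for e using that C(2) x by auto
  have "z \<in> span (insert x C)" for z
  proof -
    have "z - (x \<bullet> z) *\<^sub>R x \<in> span C" using xx by (simp add: C(3) inner_diff_right)
    then have "z - (x \<bullet> z) *\<^sub>R x \<in> span (insert x C)" using span_mono[of C "insert x C"] by blast
    moreover have "(x \<bullet> z) *\<^sub>R x \<in> span (insert x C)" by (intro span_scale span_base) simp
    ultimately show ?thesis using span_add by fastforce
  qed
  then have sp: "span Basis = span (insert x C)" by auto
  have "pairwise orthogonal (Basis :: 'a set)"
    by (auto simp: pairwise_def orthogonal_def inner_Basis)
  from orthonormal_trace[OF Dlin this _ po no sp]
  have "(\<Sum>e\<in>Basis. D e \<bullet> D e) = (\<Sum>e\<in>insert x C. D e \<bullet> D e)" by simp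
  also have "\<dots> = (real k)\<^sup>2 + (\<Sum>v\<in>C. D v \<bullet> D v)"
    using xC pairwise_orthogonal_imp_finite[OF C(1)] DxDx by simp
  finally have "(\<Sum>v\<in>C. D v \<bullet> D v) = real k * (real k + real DIM('a) - 2)"
    using tot by (simp add: power2_eq_square algebra_simps)
  \<comment> \<open>\<open>F\<close> and \<open>f\<close> agree only on the sphere, so their
    derivatives are compared along a great circle, that is, on tangent vectors.\<close>
  moreover have "sphere_differential f x v = D v" if vC: "v \<in> C" for v
  proof -
    obtain c where c: "smooth_on UNIV c" "range c \<subseteq> sphere 0 1" "c 0 = x"
      "(c has_vector_derivative v) (at (0::real))" using great_circle[of x v] x perp[OF vC] by auto
    have "((\<lambda>t. f (c t)) has_vector_derivative sphere_differential f x v) (at 0)"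
      by (rule sphere_curve_derivative[OF smooth_map_on_sphere_differential[OF sm x] zero_less_one _ c(3,4)])
        (use c(2) in auto)
    moreover have "((\<lambda>t. f (c t)) has_vector_derivative D v) (at 0)"
      by (rule sphere_curve_derivative[OF has_derivative_transform_within[OF
            has_derivative_at_withinI[OF D] zero_less_one x] zero_less_one _ c(3,4)])
        (use c(2) Ff in auto)
    ultimately show ?thesis by (rule vector_derivative_unique_at)
  qed
  ultimately show ?thesis by simp
qed

section \<open>Stability of the segment\<close>

text \<open>\<open>H1\<close> determines t^2 by m lam^2 t^2 = p lam^2 - n, the known formula for the
  angle. Eliminating t leaves an expression in n and p lam^2 only: twice the coefficient of w^2 in
  the logarithm of the squared conformal factor.\<close>

lemma stability_index:
  fixes lam t :: real and n m p :: nat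
  defines "a \<equiv> 1 + lam\<^sup>2 * t\<^sup>2"
  assumes H1: "real p * (lam\<^sup>2 - 1) = real m * a" and n: "n = p + m" and "p > 0" "m > 0" "lam > 0"
  shows "real p * (2 * (t\<^sup>2 + lam\<^sup>2) / a - 4 * t\<^sup>2 * (lam\<^sup>2 - 1)\<^sup>2 / a\<^sup>2) - 2 * real m * t\<^sup>2
    = - 2 * real n + 4 * (real n)\<^sup>2 / (real p * lam\<^sup>2)"
proof -
  define l T where "l = lam\<^sup>2" and "T = t\<^sup>2"
  have a: "a = 1 + l * T" "a > 0" unfolding a_def l_def T_def by (auto simp: add_pos_nonneg)
  have p: "real p > 0" "real m > 0" "l > 0" using assms by (auto simp: l_def)
  have H: "real p * (l - 1) = real m * a" using H1 by (simp add: l_def)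
  then have "l - 1 > 0" using p a by (metis mult_pos_pos zero_less_mult_pos)
  have mT: "real m * (l * T) = real p * l - real n"
    using H unfolding a(1) n by (simp add: algebra_simps)
  \<comment> \<open>After \<open>mT\<close>, the right side contains p l - n + m l^2, which factors
    as (l - 1)(n + m l) because n = p + m. This makes \<open>a\<close> a factor, ready to
    cancel.\<close>
  have "real m * ((T + l) * l * real p) = real p * (real m * (l * T) + real m * l * l)"
    by (simp add: algebra_simps)
  also have "\<dots> = real p * (l - 1) * (real n + real m * l)"
    unfolding mT n by (simp add: algebra_simps)
  also have "\<dots> = real m * (a * (real n + real m * l))" unfolding H by simp
  finally have TL: "(T + l) * l * real p = a * (real n + real m * l)" using p by simp
  have 1: "real p * (2 * (T + l) / a) = 2 * (real n + real m * l) / l"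
    using TL a(2) p by (simp add: field_simps)
  have "(l - 1) / a = real m / real p" using H a(2) p by (simp add: field_simps)
  then have "4 * T * (l - 1)\<^sup>2 / a\<^sup>2 = 4 * T * (real m / real p)\<^sup>2"
    by (metis power_divide times_divide_eq_right)
  then have 2: "real p * (4 * T * (l - 1)\<^sup>2 / a\<^sup>2) = 4 * real m * (real m * (l * T)) / (l * real p)"
    using p by (simp add: power2_eq_square field_simps)
  have 3: "2 * real m * T = 2 * (real m * (l * T)) / l" using p by (simp add: field_simps)
  have "real p * (2 * (T + l) / a - 4 * T * (l - 1)\<^sup>2 / a\<^sup>2) - 2 * real m * T
     = 2 * (real n + real m * l) / l - 4 * real m * (real p * l - real n) / (l * real p)
       - 2 * (real p * l - real n) / l"
    unfolding right_diff_distrib 1 2 3 mT by simp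
  also have "\<dots> = - 2 * real n + 4 * (real n)\<^sup>2 / (real p * l)"
    using p unfolding n by (simp add: field_simps power2_eq_square)
  finally show ?thesis unfolding l_def T_def .
qed

text \<open>Both 0 and lam are singular values, so neither basis is empty: 0 < p < n. The
  eigenspaces together fill the tangent hyperplane, which gives the dimension count.\<close>

lemma LOMSE_singular_bases:
  fixes f :: "'a::euclidean_space \<Rightarrow> 'b::euclidean_space"
  assumes sm: "smooth_map_on (sphere 0 1) f" and x: "x \<in> sphere 0 1"
    and vals: "singular_values f x = {0, lam}" and lam: "lam > 0"
  obtains B0 B1 where "pairwise orthogonal (B0 \<union> B1)" "\<forall>e\<in>B0 \<union> B1. norm e = 1"
    "B0 \<inter> B1 = {}" "span (B0 \<union> B1) = {v. x \<bullet> v = 0}"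
    "B0 \<subseteq> singular_space f x 0" "B1 \<subseteq> singular_space f x lam"
    "card B1 = singular_multiplicity f x lam" "card B0 > 0" "card B1 > 0"
    "card B0 + card B1 = DIM('a) - 1"
proof -
  define A where "A = sphere_differential f x"
  have A: "linear A" unfolding A_def
    using smooth_map_on_sphere_differential[OF sm x] has_derivative_linear by blast
  define T where "T = {v. x \<bullet> v = 0}"
  have T: "subspace T" unfolding T_def by (rule subspace_hyperplane)
  have E: "singular_space f x \<sigma> = {v\<in>T. \<forall>w\<in>T. A v \<bullet> A w = \<sigma>\<^sup>2 * (v \<bullet> w)}" for \<sigma>
    unfolding singular_space_def tangent_space_sphere[OF x] A_def T_def ..
  have "\<sigma> = 0 \<or> \<sigma> = lam" if "0 \<le> \<sigma>" "v \<in> singular_space f x \<sigma>" "v \<noteq> 0" for \<sigma> v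
  proof -
    have "\<sigma> \<in> singular_values f x" using that unfolding singular_values_def by blast
    then show ?thesis using vals by simp
  qed
  then have vals': "\<forall>\<sigma>\<ge>0. \<forall>v\<in>singular_space f x \<sigma>. v \<noteq> 0 \<longrightarrow> \<sigma> = 0 \<or> \<sigma> = lam" by blast
  obtain B0 B1 where B: "pairwise orthogonal (B0 \<union> B1)" "\<forall>e\<in>B0 \<union> B1. norm e = 1"
    "B0 \<inter> B1 = {}" "span (B0 \<union> B1) = T" "B0 \<subseteq> singular_space f x 0" "B1 \<subseteq> singular_space f x lam"
    "card B0 = dim (singular_space f x 0)" "card B1 = dim (singular_space f x lam)"
    using singular_decomposition[OF A T lam vals'[unfolded E], folded E] by metis
  have dim: "dim (singular_space f x \<sigma>) > 0" if \<sigma>: "\<sigma> \<in> singular_values f x" for \<sigma>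
  proof -
    obtain v where "v \<in> singular_space f x \<sigma>" "v \<noteq> 0" using \<sigma> unfolding singular_values_def by blast
    then show ?thesis by (metis dim_eq_0 gr0I singletonD subsetD)
  qed
  have "0 \<notin> B0 \<union> B1" using B(2) by force
  then have "independent (B0 \<union> B1)" using B(1) pairwise_orthogonal_independent by blast
  then have "card (B0 \<union> B1) = dim T" using B(4) dim_span_eq_card_independent by metis
  also have "dim T = DIM('a) - 1" unfolding T_def using x by (intro dim_hyperplane) auto
  finally have "card B0 + card B1 = DIM('a) - 1"
    using B(3) pairwise_orthogonal_imp_finite[OF B(1)] by (simp add: card_Un_disjoint)
  moreover have "card B0 > 0" "card B1 > 0" using dim vals B(7,8) by auto
  ultimately show ?thesis
    using that B unfolding singular_multiplicity_def T_def by blast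
qed

text \<open>In a basis of singular vectors the energy is the multiplicity times lam^2. With DIM = n
  + 1 this is the formula for lam in terms of (n, p, k).\<close>

lemma LOMSE_type_energy:
  fixes f :: "'a::euclidean_space \<Rightarrow> 'b::euclidean_space"
  assumes sm: "smooth_map_on (sphere 0 1) f" and f: "f ` sphere 0 1 \<subseteq> sphere 0 1"
    and har: "\<forall>b\<in>Basis. spherical_harmonic k (\<lambda>x. f x \<bullet> b)" and k: "k > 0"
    and x: "x \<in> sphere 0 1"
    and B: "pairwise orthogonal (B0 \<union> B1)" "\<And>e. e \<in> B0 \<union> B1 \<Longrightarrow> norm e = 1" "B0 \<inter> B1 = {}"
      "span (B0 \<union> B1) = {v. x \<bullet> v = 0}"
    and B0: "B0 \<subseteq> singular_space f x 0" and B1: "B1 \<subseteq> singular_space f x lam"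
  shows "real (card B1) * lam\<^sup>2 = real k * (real k + real DIM('a) - 2)"
proof -
  define A where "A = sphere_differential f x"
  have "A v \<bullet> A v = \<sigma>\<^sup>2 * (v \<bullet> v)" if "v \<in> singular_space f x \<sigma>" for v \<sigma>
    using that by (simp add: singular_space_def A_def)
  moreover have "v \<bullet> v = 1" if "v \<in> B0 \<union> B1" for v using B(2)[OF that] by (simp add: norm_eq_1)
  ultimately have AA: "\<And>v. v \<in> B0 \<Longrightarrow> A v \<bullet> A v = 0" "\<And>v. v \<in> B1 \<Longrightarrow> A v \<bullet> A v = lam\<^sup>2"
    using B0 B1 by force+
  have "(\<Sum>v\<in>B0 \<union> B1. A v \<bullet> A v) = (\<Sum>v\<in>B0. A v \<bullet> A v) + (\<Sum>v\<in>B1. A v \<bullet> A v)"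
    using pairwise_orthogonal_imp_finite[OF B(1)] B(3) by (intro sum.union_disjoint) auto
  also have "\<dots> = real (card B1) * lam\<^sup>2" using AA by simp
  finally show ?thesis
    using spherical_harmonic_energy[OF sm f har k x B(1,2,4)] by (simp add: A_def)
qed

theorem theorem1p2:
  fixes f :: "'a::euclidean_space \<Rightarrow> 'b::euclidean_space"
    and n m p :: nat and \<theta> lam :: real and x :: 'a
  assumes "DIM('a) = n + 1" and "DIM('b) = m + 1"
    and "LOMSE f" and "LOMSE_type_I f" and "LOM_angle f \<theta>"
    and "x \<in> sphere 0 1" and "lam > 0" and "lam \<in> singular_values f x"
    and "p = singular_multiplicity f x lam"
  shows "stable_geodesic_segment quotient_space (quotient_metric n p lam) {0<..1} (LOC_curve \<theta>)"
proof -
  have sm: "smooth_map_on (sphere 0 1) f" and f: "f ` sphere 0 1 \<subseteq> sphere 0 1"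
    using assms(3) by (auto simp: LOMSE_def LOM_def)
  obtain lam' where "singular_values f x = {0, lam'}"
    using assms(3,6) unfolding LOMSE_def by blast
  \<comment> \<open>A positive element of \<open>{0, lam'}\<close> is \<open>lam'\<close>
    itself.\<close>
  then have vals: "singular_values f x = {0, lam}" using assms(7,8) by auto
  obtain B0 B1 where B: "pairwise orthogonal (B0 \<union> B1)" "\<And>e. e \<in> B0 \<union> B1 \<Longrightarrow> norm e = 1"
    "B0 \<inter> B1 = {}" "span (B0 \<union> B1) = {v. x \<bullet> v = 0}"
    "B0 \<subseteq> singular_space f x 0" "B1 \<subseteq> singular_space f x lam"
    and cards: "card B1 = singular_multiplicity f x lam" "card B0 > 0" "card B1 > 0"
    "card B0 + card B1 = DIM('a) - 1"
    using LOMSE_singular_bases[OF sm assms(6) vals assms(7)] by metis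
  define q where "q = card B0"
  have p: "card B1 = p" "p > 0" "q > 0" "n = p + q" "n - p = q"
    using cards assms(1,9) by (auto simp: q_def)
  have H1: "real p * (lam\<^sup>2 - 1) = real (n - p) * (1 + lam\<^sup>2 * (tan \<theta>)\<^sup>2)"
    using LOM_angle_equation[OF sm f assms(5,6,7) B] p(1,5) by (simp add: q_def)
  have pl: "real p * lam\<^sup>2 > 0" using p(2) assms(7) by simp
  have ineq: "n \<ge> 2 \<and> - 2 * ((real n - 1) / 2)\<^sup>2 < - 2 * real n + 4 * (real n)\<^sup>2 / (real p * lam\<^sup>2)"
  proof (cases "n \<ge> 7")
    case True
    have "4 * (real n)\<^sup>2 / (real p * lam\<^sup>2) > 0" using pl True by simp
    moreover have "- 2 * ((real n - 1) / 2)\<^sup>2 \<le> - 2 * real n"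
    proof -
      \<comment> \<open>The larger root of n^2 - 6 n + 1 is 3 + 2 sqrt 2 < 7, so the positive term
        in p lam^2 can be discarded.\<close>
      have "(real n - 1)\<^sup>2 - 4 * real n = (real n - 7) * (real n + 1) + 8"
        by (simp add: power2_eq_square algebra_simps)
      also have "\<dots> \<ge> 0" using True by simp
      finally show ?thesis by (simp add: power_divide)
    qed
    ultimately show ?thesis using True by simp
  next
    case False
    then obtain n' p' k where ty: "LOMSE_type f n' p' k"
      and npk: "(n', p', k) \<in> {(3, 2, 2), (5, 4, 2), (5, 4, 4)}"
      using assms(1,4) unfolding LOMSE_type_I_def by auto
    have n': "n' = n" using ty assms(1) by (simp add: LOMSE_type_def)
    have har: "\<forall>b\<in>Basis. spherical_harmonic k (\<lambda>x. f x \<bullet> b)" using ty by (simp add: LOMSE_type_def)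
    have "k > 0" using npk by auto
    from LOMSE_type_energy[OF sm f har this assms(6) B]
    have "real p * lam\<^sup>2 = real k * (real k + real n - 1)" using p(1) assms(1) by simp
    \<comment> \<open>p lam^2 is 8, 12 and 32 for the three types, and the inequality reads -3/2 >
      -2, -5/3 > -8 and -55/8 > -8.\<close>
    then show ?thesis using npk unfolding n' by (auto simp: power2_eq_square)
  qed
  have "real p * (2 * ((tan \<theta>)\<^sup>2 + lam\<^sup>2) / (1 + lam\<^sup>2 * (tan \<theta>)\<^sup>2)
      - 4 * (tan \<theta>)\<^sup>2 * (lam\<^sup>2 - 1)\<^sup>2 / (1 + lam\<^sup>2 * (tan \<theta>)\<^sup>2)\<^sup>2) - 2 * real (n - p) * (tan \<theta>)\<^sup>2
      > - 2 * ((real n - 1) / 2)\<^sup>2"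
    using stability_index[OF H1 _ p(2) _ assms(7), of n] p ineq by simp
  from LOC_segment_stable[OF _ _ H1 this] ineq p(4) show ?thesis by simp
qed

end
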